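(* Assume a periodic boundary condition in space and an infinite velocity domain $\mathbb R^3$. Let $(f^{n+1},\boldsymbol B^{n+1},p^{n+1})$ be obtained from $(f^n,\boldsymbol B^n,p^n)$ by one step of the time discretization (modified mid-point rule) described in the context. Then mass, momentum and energy are conserved: $$\mathcal M^{n+1}=\mathcal M^n,\qquad \mathcal P^{n+1}=\mathcal P^n,\qquad \mathcal E^{n+1}=\mathcal E^n .$$ Moreover the cancellation problem is overcome: the contributions of the terms $\boldsymbol v\times\boldsymbol B^{n+\frac12}$ and $-\bar{\boldsymbol u}\times\boldsymbol B^{n+\frac12}$ to the change of $\boldsymbol J_f=\int\boldsymbol v f\,\mathrm d\boldsymbol v$ over the step cancel each other, so that $$\boldsymbol J_f^{n+1}-\boldsymbol J_f^{n}=\Delta t\,(\nabla\times\boldsymbol B^{n+\frac12})\times\boldsymbol B^{n+\frac12}-\Delta t\,\nabla p^{n+\frac12}.$$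
   Context: Unknowns: $f(\boldsymbol x,\boldsymbol v)$ (ion distribution function), $\boldsymbol B(\boldsymbol x)\in\mathbb R^3$ (magnetic field, satisfying $\nabla\cdot\boldsymbol B=0$), $p(\boldsymbol x)$ (electron pressure), with $\boldsymbol x$ in a three-dimensional periodic box and $\boldsymbol v\in\mathbb R^3$; $\gamma\neq1$ is a constant and $\Delta t>0$ is the time step, $t^{n+1}=t^n+\Delta t$. All functions are assumed sufficiently smooth, $f$ decays sufficiently fast as $|\boldsymbol v|\to\infty$ for the integrals below and integrations by parts in $\boldsymbol v$ to be valid, and $\rho=\int f\,\mathrm d\boldsymbol v>0$. For a field $a$ write $a^{n+\frac12}=\frac12(a^n+a^{n+1})$. The mean velocity is $\boldsymbol u^n=\frac1\rho\int\boldsymbol v f^n\,\mathrm d\boldsymbol v$. Conserved quantities: $$\mathcal M=\int f\,\mathrm d\boldsymbol x\,\mathrm d\boldsymbol v,\quad \mathcal P=\int\boldsymbol v f\,\mathrm d\boldsymbol x\,\mathrm d\boldsymbol v,\quad \mathcal E=\frac12\int|\boldsymbol v|^2f\,\mathrm d\boldsymbol x\,\mathrm d\boldsymbol v+\frac12\int|\boldsymbol B|^2\,\mathrm d\boldsymbol x+\int\frac{p}{\gamma-1}\,\mathrm d\boldsymbol x .$$ One step of the scheme (with $\rho=\int f^n\,\mathrm d\boldsymbol v$, which does not change during the step): (i) $f^{n+1}(\boldsymbol x,\boldsymbol v)=f(t^{n+1},\boldsymbol x,\boldsymbol v)$, where $f(t,\cdot,\cdot)$, $t\in[t^n,t^{n+1}]$,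 is the exact solution with $f(t^n)=f^n$ of $$\frac{\partial f}{\partial t}+\Big[\Big(\boldsymbol v-\bar{\boldsymbol u}+\frac{\nabla\times\boldsymbol B^{n+\frac12}}{\rho}\Big)\times\boldsymbol B^{n+\frac12}\Big]\cdot\frac{\partial f}{\partial\boldsymbol v}-\frac{\nabla p^{n+\frac12}}{\rho}\cdot\frac{\partial f}{\partial\boldsymbol v}=0;$$ (ii) $\displaystyle\frac{\boldsymbol B^{n+1}-\boldsymbol B^n}{\Delta t}=\nabla\times\big(\bar{\boldsymbol u}\times\boldsymbol B^{n+\frac12}\big)-\nabla\times\Big(\frac{\nabla\times\boldsymbol B^{n+\frac12}}{\rho}\times\boldsymbol B^{n+\frac12}\Big)+\nabla\times\frac{\nabla p^{n+\frac12}}{\rho}$; (iii) $\displaystyle\frac{p^{n+1}-p^n}{\Delta t}+\nabla\cdot\big(p^{n+\frac12}\bar{\boldsymbol u}_e\big)+(\gamma-1)p^{n+\frac12}\,\nabla\cdot\bar{\boldsymbol u}_e=0$, with $\bar{\boldsymbol u}_e=\bar{\boldsymbol u}-\frac{\nabla\times\boldsymbol B^{n+\frac12}}{\rho}$; (iv) the vector field $\bar{\boldsymbol u}(\boldsymbol x)$ satisfies $\bar{\boldsymbol u}=\frac1{\Delta t}\int_{t^n}^{t^{n+1}}\boldsymbol u(t)\,\mathrm dt$, where $\boldsymbol u(t)$ solves, at each $\boldsymbol x$, $$\frac{\partial\boldsymbol u}{\partial t}=\Big(\boldsymbol u-\bar{\boldsymbol u}+\frac{\nabla\times\boldsymbol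 B^{n+\frac12}}{\rho}\Big)\times\boldsymbol B^{n+\frac12}-\frac{\nabla p^{n+\frac12}}{\rho},\qquad\boldsymbol u(t^n)=\boldsymbol u^n .$$ "Cancellation problem": in the continuous model the contributions of $\boldsymbol v\times\boldsymbol B$ and $-\boldsymbol u\times\boldsymbol B$ cancel in the evolution of $\boldsymbol J_f$, giving $\partial_t\boldsymbol J_f=-\nabla p+(\nabla\times\boldsymbol B)\times\boldsymbol B$; the problem is overcome when this cancellation is preserved by the discretization. *)

theory Defs
  imports "HOL-Analysis.Analysis"
begin

unbundle cross3_syntax

text \<open>
  Positions and velocities both live in \<^typ>\<open>real^3\<close>; the periodic box is \<open>cbox 0 L\<close> and fields on it
  are represented by periodic functions on the whole space. The symbol \<open>\<times>\<close> is the cross product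
  of HOL-Analysis; products of sets are written \<open>Product_Type.Times\<close>.
\<close>

section \<open>Vector calculus\<close>

text \<open>\<open>k\<close> times continuously differentiable: all iterated partial derivatives up to order \<open>k\<close> exist
  (as values of Frechet derivatives) and are continuous.\<close>

primrec Ck :: "nat \<Rightarrow> ('a::euclidean_space \<Rightarrow> 'b::real_normed_vector) \<Rightarrow> bool" where
  "Ck 0 g \<longleftrightarrow> continuous_on UNIV g"
| "Ck (Suc k) g \<longleftrightarrow> (\<forall>x. g differentiable (at x)) \<and>
      (\<forall>b\<in>Basis. Ck k (\<lambda>x. frechet_derivative g (at x) b))"

definition pd :: "3 \<Rightarrow> (real^3 \<Rightarrow> 'b::real_normed_vector) \<Rightarrow> real^3 \<Rightarrow> 'b" where
  "pd i g x = frechet_derivative g (at x) (axis i 1)"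

definition grad :: "(real^3 \<Rightarrow> real) \<Rightarrow> real^3 \<Rightarrow> real^3" where
  "grad g x = (\<chi> i. pd i g x)"

definition divergence :: "(real^3 \<Rightarrow> real^3) \<Rightarrow> real^3 \<Rightarrow> real" where
  "divergence F x = (\<Sum>i\<in>UNIV. pd i F x $ i)"

definition curl :: "(real^3 \<Rightarrow> real^3) \<Rightarrow> real^3 \<Rightarrow> real^3" where
  "curl F x = vector [pd 2 F x $ 3 - pd 3 F x $ 2,
                      pd 3 F x $ 1 - pd 1 F x $ 3,
                      pd 1 F x $ 2 - pd 2 F x $ 1]"

definition periodic :: "real^3 \<Rightarrow> (real^3 \<Rightarrow> 'b) \<Rightarrow> bool" where
  "periodic L g \<longleftrightarrow> (\<forall>x i. g (x + axis i (L $ i)) = g x)"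

section \<open>Velocity moments and conserved quantities\<close>

text \<open>A distribution function at a fixed time is a curried function of position and velocity.\<close>

definition mass_density :: "(real^3 \<Rightarrow> real^3 \<Rightarrow> real) \<Rightarrow> real^3 \<Rightarrow> real" where
  "mass_density g x = (LINT v|lborel. g x v)"

definition Jf :: "(real^3 \<Rightarrow> real^3 \<Rightarrow> real) \<Rightarrow> real^3 \<Rightarrow> real^3" where
  "Jf g x = (LINT v|lborel. g x v *\<^sub>R v)"

definition mean_velocity :: "(real^3 \<Rightarrow> real^3 \<Rightarrow> real) \<Rightarrow> real^3 \<Rightarrow> real^3" where
  "mean_velocity g x = (1 / mass_density g x) *\<^sub>R Jf g x"

definition phase_space :: "real^3 \<Rightarrow> ((real^3) \<times> (real^3)) set" where
  "phase_space L = Product_Type.Times (cbox 0 L) UNIV"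

definition total_mass :: "real^3 \<Rightarrow> (real^3 \<Rightarrow> real^3 \<Rightarrow> real) \<Rightarrow> real" where
  "total_mass L g = (LINT z:phase_space L|lborel. g (fst z) (snd z))"

definition total_momentum :: "real^3 \<Rightarrow> (real^3 \<Rightarrow> real^3 \<Rightarrow> real) \<Rightarrow> real^3" where
  "total_momentum L g = (LINT z:phase_space L|lborel. g (fst z) (snd z) *\<^sub>R snd z)"

definition total_energy ::
  "real \<Rightarrow> real^3 \<Rightarrow> (real^3 \<Rightarrow> real^3 \<Rightarrow> real) \<Rightarrow> (real^3 \<Rightarrow> real^3) \<Rightarrow> (real^3 \<Rightarrow> real) \<Rightarrow> real" where
  "total_energy \<gamma> L g B p =
     1/2 * (LINT z:phase_space L|lborel. (norm (snd z))\<^sup>2 * g (fst z) (snd z))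
   + 1/2 * (LINT x:cbox 0 L|lborel. (norm (B x))\<^sup>2)
   + (LINT x:cbox 0 L|lborel. p x / (\<gamma> - 1))"

section \<open>Regularity and decay of the distribution function\<close>

definition C1_in_velocity ::
  "real \<Rightarrow> real \<Rightarrow> (real \<Rightarrow> real^3 \<Rightarrow> real^3 \<Rightarrow> real) \<Rightarrow> bool" where
  "C1_in_velocity t0 t1 f \<longleftrightarrow>
     continuous_on (Product_Type.Times {t0..t1} UNIV) (\<lambda>(t, x, v). f t x v) \<and>
     (\<forall>t\<in>{t0..t1}. \<forall>x v. f t x differentiable (at v)) \<and>
     continuous_on (Product_Type.Times {t0..t1} UNIV) (\<lambda>(t, x, v). grad (f t x) v)"

text \<open>The exponents make \<open>|v|\<^sup>2 f\<close> and \<open>|v|\<^sup>3 \<nabla>\<^sub>v f\<close> of order \<open>|v|\<^sup>-\<^sup>6\<close>, hence integrable over velocity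
  space: the force grows linearly in \<open>v\<close>, so these are the largest terms that occur in the evolution
  of the moments up to order two.\<close>

definition decays_in_velocity ::
  "real \<Rightarrow> real \<Rightarrow> (real \<Rightarrow> real^3 \<Rightarrow> real^3 \<Rightarrow> real) \<Rightarrow> bool" where
  "decays_in_velocity t0 t1 f \<longleftrightarrow>
     (\<exists>C. \<forall>t\<in>{t0..t1}. \<forall>x v. (1 + norm v) ^ 8 * \<bar>f t x v\<bar> \<le> C \<and>
                            (1 + norm v) ^ 9 * norm (grad (f t x) v) \<le> C)"

section \<open>The modified mid-point scheme\<close>

text \<open>In the following \<open>Bh\<close> and \<open>ph\<close> stand for the half-step averages \<open>B\<^sup>n\<^sup>+\<^sup>1\<^sup>/\<^sup>2\<close> and \<open>p\<^sup>n\<^sup>+\<^sup>1\<^sup>/\<^sup>2\<close>,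
  \<open>\<rho>\<close> for the density and \<open>ub\<close> for the averaged velocity of the step.\<close>

definition half :: "(real^3 \<Rightarrow> 'b::real_vector) \<Rightarrow> (real^3 \<Rightarrow> 'b) \<Rightarrow> real^3 \<Rightarrow> 'b" where
  "half a b x = midpoint (a x) (b x)"

definition acceleration ::
  "(real^3 \<Rightarrow> real) \<Rightarrow> (real^3 \<Rightarrow> real^3) \<Rightarrow> (real^3 \<Rightarrow> real^3) \<Rightarrow> (real^3 \<Rightarrow> real) \<Rightarrow>
   real^3 \<Rightarrow> real^3 \<Rightarrow> real^3" where
  "acceleration \<rho> ub Bh ph x v =
     (v - ub x + (1 / \<rho> x) *\<^sub>R curl Bh x) \<times> Bh x - (1 / \<rho> x) *\<^sub>R grad ph x"

definition vlasov_solution ::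
  "real \<Rightarrow> real \<Rightarrow> (real^3 \<Rightarrow> real) \<Rightarrow> (real^3 \<Rightarrow> real^3) \<Rightarrow> (real^3 \<Rightarrow> real^3) \<Rightarrow> (real^3 \<Rightarrow> real) \<Rightarrow>
   (real \<Rightarrow> real^3 \<Rightarrow> real^3 \<Rightarrow> real) \<Rightarrow> bool" where
  "vlasov_solution t0 t1 \<rho> ub Bh ph f \<longleftrightarrow>
     (\<forall>t\<in>{t0..t1}. \<forall>x v.
        ((\<lambda>s. f s x v) has_real_derivative - (acceleration \<rho> ub Bh ph x v \<bullet> grad (f t x) v))
          (at t within {t0..t1}))"

definition faraday_step ::
  "real \<Rightarrow> (real^3 \<Rightarrow> real) \<Rightarrow> (real^3 \<Rightarrow> real^3) \<Rightarrow> (real^3 \<Rightarrow> real^3) \<Rightarrow> (real^3 \<Rightarrow> real) \<Rightarrow>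
   (real^3 \<Rightarrow> real^3) \<Rightarrow> (real^3 \<Rightarrow> real^3) \<Rightarrow> bool" where
  "faraday_step dt \<rho> ub Bh ph B0 B1 \<longleftrightarrow>
     (\<forall>x. (1 / dt) *\<^sub>R (B1 x - B0 x) =
        curl (\<lambda>y. ub y \<times> Bh y) x
        - curl (\<lambda>y. ((1 / \<rho> y) *\<^sub>R curl Bh y) \<times> Bh y) x
        + curl (\<lambda>y. (1 / \<rho> y) *\<^sub>R grad ph y) x)"

definition electron_velocity ::
  "(real^3 \<Rightarrow> real) \<Rightarrow> (real^3 \<Rightarrow> real^3) \<Rightarrow> (real^3 \<Rightarrow> real^3) \<Rightarrow> real^3 \<Rightarrow> real^3" where
  "electron_velocity \<rho> ub Bh x = ub x - (1 / \<rho> x) *\<^sub>R curl Bh x"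

definition pressure_step ::
  "real \<Rightarrow> real \<Rightarrow> (real^3 \<Rightarrow> real) \<Rightarrow> (real^3 \<Rightarrow> real^3) \<Rightarrow> (real^3 \<Rightarrow> real^3) \<Rightarrow> (real^3 \<Rightarrow> real) \<Rightarrow>
   (real^3 \<Rightarrow> real) \<Rightarrow> (real^3 \<Rightarrow> real) \<Rightarrow> bool" where
  "pressure_step dt \<gamma> \<rho> ub Bh ph p0 p1 \<longleftrightarrow>
     (\<forall>x. (p1 x - p0 x) / dt
        + divergence (\<lambda>y. ph y *\<^sub>R electron_velocity \<rho> ub Bh y) x
        + (\<gamma> - 1) * ph x * divergence (electron_velocity \<rho> ub Bh) x = 0)"

definition velocity_solution ::
  "real \<Rightarrow> real \<Rightarrow> (real^3 \<Rightarrow> real) \<Rightarrow> (real^3 \<Rightarrow> real^3) \<Rightarrow> (real^3 \<Rightarrow> real^3) \<Rightarrow> (real^3 \<Rightarrow> real) \<Rightarrow>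
   (real \<Rightarrow> real^3 \<Rightarrow> real^3) \<Rightarrow> bool" where
  "velocity_solution t0 t1 \<rho> ub Bh ph u \<longleftrightarrow>
     (\<forall>t\<in>{t0..t1}. \<forall>x.
        ((\<lambda>s. u s x) has_vector_derivative acceleration \<rho> ub Bh ph x (u t x))
          (at t within {t0..t1}))"

text \<open>A force term \<open>a(v) \<cdot> \<nabla>\<^sub>v f\<close> on the left-hand side of the kinetic equation changes
  \<open>J\<^sub>f = \<integral>v f dv\<close> over the step by the following amount, at a fixed position \<open>x\<close>.\<close>

definition J_contribution ::
  "real \<Rightarrow> real \<Rightarrow> (real \<Rightarrow> real^3 \<Rightarrow> real^3 \<Rightarrow> real) \<Rightarrow> real^3 \<Rightarrow> (real^3 \<Rightarrow> real^3) \<Rightarrow> real^3" where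
  "J_contribution t0 t1 f x a =
     (LINT t:{t0..t1}|lborel. LINT v|lborel. - (a v \<bullet> grad (f t x) v) *\<^sub>R v)"

end

theory Submission
  imports Defs
begin

text \<open>
  At a fixed position \<open>x\<close> the acceleration is an affine function \<open>a(v) = v \<times> b + c\<close> of the velocity, with
  \<open>b\<close> the half-step magnetic field at \<open>x\<close> and \<open>c\<close> constant during the step, and it is divergence free in \<open>v\<close>.
  Hence every moment \<open>\<integral>\<phi> f dv\<close> with \<open>\<phi>\<close> of at most quadratic growth is differentiable in time with derivative
  \<open>\<integral>(\<phi>'(v) a(v)) f dv\<close> (lemma \<open>moment_has_vector_derivative\<close>), and for \<open>\<phi> = 1, v, |v|\<^sup>2\<close> this derivative
  is again an expression in the density \<open>\<rho>\<close> and the momentum density \<open>J\<close>: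
  \<open>\<rho>' = 0\<close>, \<open>J' = J \<times> b + \<rho> c\<close>, and \<open>2 J \<bullet> c\<close> for the second moment.

  The auxiliary velocity \<open>u\<close> solves \<open>u' = u \<times> b + c\<close> with the same initial value as \<open>J / \<rho>\<close>. The difference
  \<open>w = J - \<rho> u\<close> satisfies \<open>w' = w \<times> b\<close>, so \<open>|w|\<close> is constant and \<open>J = \<rho> u\<close> throughout the step
  (lemma \<open>momentum_eq\<close>). This is the point of the scheme: the time average of \<open>J\<close> is exactly \<open>\<rho>\<close> times the averaged
  velocity that enters \<open>c\<close> through \<open>- ub \<times> Bh\<close>, so after integration in time the two contributions cancel,
  the increment of \<open>J\<close> is \<open>dt ((curl Bh) \<times> Bh - grad ph)\<close>, and the increment of the kinetic energy
  density is \<open>dt (ub \<bullet> ((curl Bh) \<times> Bh) - ub \<bullet> grad ph)\<close>.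

  Conservation is then a matter of recognising divergences, which integrate to zero over the periodic box
  (lemma \<open>integral_pd_periodic\<close>). For momentum, \<open>(curl B) \<times> B\<close> is the divergence of the Maxwell stress whenever
  \<open>div B = 0\<close>; the Faraday step keeps the magnetic field divergence free because \<open>div curl = 0\<close>.
  For energy, the mid-point values make \<open>(|Bn1|\<^sup>2 - |Bn|\<^sup>2) / 2 = (Bn1 - Bn) \<bullet> Bh\<close>, and with \<open>E\<close>
  the electric field of the step up to sign, the sum of the kinetic, magnetic and internal increments is,
  at each point, a combination of the divergences of \<open>E \<times> Bh\<close> and of \<open>ph\<close> times the electron velocity.
\<close>

section \<open>Decaying functions of velocity\<close>

lemma nn_integral_powr_finite: "(\<integral>\<^sup>+s. ennreal ((1 + \<bar>s\<bar>) powr (-3/2)) \<partial>lborel) < \<infinity>"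
proof -
  let ?h = "\<lambda>s::real. (1 + \<bar>s\<bar>) powr (-3/2)"
  have lim: "((\<lambda>s::real. - 2 * (1 + s) powr (-1/2)) \<longlongrightarrow> - 2 * 0) at_top"
    by (intro tendsto_mult_left tendsto_neg_powr filterlim_tendsto_add_at_top[OF tendsto_const filterlim_ident]) auto
  have half: "(\<integral>\<^sup>+s. ennreal (?h s) * indicator {0..} s \<partial>lborel) = ennreal 2"
  proof -
    have "(\<integral>\<^sup>+s. ennreal (?h s) * indicator {0..} s \<partial>lborel)
        = (\<integral>\<^sup>+s. ennreal ((1 + s) powr (-3/2)) * indicator {0..} s \<partial>lborel)"
      by (intro nn_integral_cong) (auto simp: indicator_def)
    also have "\<dots> = ennreal (- 2 * 0 - (- 2 * (1 + 0) powr (-1/2)))"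
    proof (rule nn_integral_FTC_atLeast[OF _ _ _ lim])
      show "((\<lambda>s. - 2 * (1 + s) powr (-1/2)) has_real_derivative (1 + s) powr (-3/2)) (at s)"
        if "0 \<le> s" for s :: real
        using that by (auto intro!: derivative_eq_intros simp: field_simps)
    qed auto
    finally show ?thesis by simp
  qed
  have "(\<integral>\<^sup>+s. ennreal (?h s) \<partial>lborel)
      \<le> (\<integral>\<^sup>+s. ennreal (?h s) * indicator {0..} s + ennreal (?h s) * indicator {0..} (- s) \<partial>lborel)"
    by (intro nn_integral_mono) (auto simp: indicator_def)
  also have "\<dots> = (\<integral>\<^sup>+s. ennreal (?h s) * indicator {0..} s \<partial>lborel)
      + (\<integral>\<^sup>+s. ennreal (?h s) * indicator {0..} (- s) \<partial>lborel)"
    by (intro nn_integral_add) auto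
  also have "(\<integral>\<^sup>+s. ennreal (?h s) * indicator {0..} (- s) \<partial>lborel)
      = (\<integral>\<^sup>+s. ennreal (?h s) * indicator {0..} s \<partial>lborel)"
    by (subst nn_integral_real_affine[where c = "-1" and t = 0]) auto
  finally show ?thesis
    unfolding half by (rule order_le_less_trans) simp
qed

text \<open>
  Since \<open>1 + |v|\<close> dominates \<open>1 + |v \<bullet> b|\<close> in each of the three coordinate directions, a power
  of \<open>1 + |v|\<close> with exponent above \<open>3\<close> is bounded below by a product of one-dimensional weights with exponent
  above \<open>1\<close>; the choice here is \<open>3/2\<close>, with total \<open>9/2 \<le> 5\<close>. The order \<open>5\<close> is the slowest
  decay below: that of \<open>|v|\<^sup>2 a(v) f\<close> when \<open>a\<close> is affine and \<open>f\<close> is of order \<open>|v|\<^sup>-\<^sup>8\<close>.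
\<close>

lemma integrable_inverse_power_norm:
  "integrable lborel (\<lambda>v::real^3. inverse ((1 + norm v) ^ 5))"
proof -
  let ?h = "\<lambda>s::real. (1 + \<bar>s\<bar>) powr (-3/2)"
  have int: "integrable lborel (\<lambda>v::real^3. \<Prod>b\<in>Basis. ?h (v \<bullet> b))"
  proof (rule integrableI_bounded)
    show "(\<lambda>v::real^3. \<Prod>b\<in>Basis. ?h (v \<bullet> b)) \<in> borel_measurable lborel"
      by (intro borel_measurable_prod) simp
    have "(\<integral>\<^sup>+v. ennreal (norm (\<Prod>b\<in>Basis. ?h ((v::real^3) \<bullet> b))) \<partial>lborel)
        = (\<integral>\<^sup>+v. (\<Prod>b\<in>Basis. ennreal (?h ((v::real^3) \<bullet> b))) \<partial>lborel)"
      by (intro nn_integral_cong) (simp add: prod_nonneg prod_ennreal abs_of_nonneg)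
    also have "\<dots> = (\<Prod>b\<in>(Basis::(real^3) set). \<integral>\<^sup>+s. ennreal (?h s) \<partial>lborel)"
      by (rule nn_integral_lborel_prod) auto
    also have "\<dots> < \<infinity>"
      using nn_integral_powr_finite by (simp add: power_less_top_ennreal)
    finally show "(\<integral>\<^sup>+v. ennreal (norm (\<Prod>b\<in>Basis. ?h ((v::real^3) \<bullet> b))) \<partial>lborel) < \<infinity>" .
  qed
  have le: "norm (inverse ((1 + norm v) ^ 5)) \<le> norm (\<Prod>b\<in>Basis. ?h (v \<bullet> b))" for v :: "real^3"
  proof -
    have pos: "0 < 1 + norm v"
      by (simp add: add_pos_nonneg)
    have "inverse ((1 + norm v) ^ 5) = (1 + norm v) powr (-5)"
      using pos by (simp add: powr_minus)
    also have "\<dots> \<le> (1 + norm v) powr (-9/2)"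
      by (intro powr_mono) auto
    also have "\<dots> = (\<Prod>b\<in>(Basis::(real^3) set). (1 + norm v) powr (-3/2))"
      using pos by (simp add: powr_power)
    also have "\<dots> \<le> (\<Prod>b\<in>(Basis::(real^3) set). ?h (v \<bullet> b))"
      by (intro prod_mono conjI powr_mono2') (auto simp: Basis_le_norm add_pos_nonneg)
    finally show ?thesis
      using pos by (simp add: prod_nonneg abs_of_nonneg)
  qed
  show ?thesis
    by (rule Bochner_Integration.integrable_bound[OF int]) (measurable, rule AE_I2, rule le)
qed

lemma norm_le_of_decay:
  fixes y :: "'b::real_normed_vector" and v :: "real^3"
  assumes "(1 + norm v) ^ 5 * norm y \<le> C"
  shows "norm y \<le> C * inverse ((1 + norm v) ^ 5)"
proof -
  have "0 < (1 + norm v) ^ 5" by (simp add: add_pos_nonneg)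
  then show ?thesis using assms by (simp add: pos_le_divide_eq mult.commute flip: divide_inverse)
qed

lemma integrable_of_decay:
  fixes g :: "real^3 \<Rightarrow> 'b::euclidean_space"
  assumes "continuous_on UNIV g" and "\<And>v. (1 + norm v) ^ 5 * norm (g v) \<le> C"
  shows "integrable lborel g"
proof (rule Bochner_Integration.integrable_bound)
  show "integrable lborel (\<lambda>v::real^3. C * inverse ((1 + norm v) ^ 5))"
    by (intro integrable_mult_right integrable_inverse_power_norm)
  show "g \<in> borel_measurable lborel"
    using borel_measurable_continuous_onI[OF assms(1)] by simp
  show "AE v in lborel. norm (g v) \<le> norm (C * inverse ((1 + norm v) ^ 5))"
    by (rule AE_I2, rule order_trans[OF norm_le_of_decay[OF assms(2)]]) simp
qed

text \<open>
  The compact set \<open>S\<close> will be a time interval, the segment of a translation, or the periodic box. The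
  weight \<open>(1 + |v|)\<^sup>-\<^sup>5\<close> on \<open>S \<times> UNIV\<close> is a product of integrable functions, and a multiple of it
  dominates \<open>h\<close>.
\<close>

lemma
  fixes h :: "'a::euclidean_space \<Rightarrow> real^3 \<Rightarrow> 'b::euclidean_space"
  assumes S: "compact S"
    and cont: "continuous_on (Product_Type.Times S UNIV) (\<lambda>(s, v). h s v)"
    and bound: "\<And>s v. s \<in> S \<Longrightarrow> (1 + norm v) ^ 5 * norm (h s v) \<le> C"
  shows Fubini_of_decay: "(LINT v|lborel. (LINT s:S|lborel. h s v)) = (LINT s:S|lborel. LINT v|lborel. h s v)"
    and set_integrable_of_decay: "set_integrable lborel S (\<lambda>s. LINT v|lborel. h s v)"
    and integral_pair_of_decay:
      "(LINT z:Product_Type.Times S UNIV|lborel. h (fst z) (snd z)) = (LINT s:S|lborel. LINT v|lborel. h s v)"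
proof -
  let ?H = "\<lambda>s v. indicator S s *\<^sub>R h s v"
  let ?w = "\<lambda>v::real^3. inverse ((1 + norm v) ^ 5)"
  have [measurable]: "S \<in> sets borel"
    using S by (simp add: borel_compact)
  have eq: "(\<lambda>z. indicator (Product_Type.Times S UNIV) z *\<^sub>R h (fst z) (snd z)) = (\<lambda>(s, v). ?H s v)"
    by (auto simp: fun_eq_iff indicator_def)
  have SU: "Product_Type.Times S (UNIV :: (real^3) set) \<in> sets borel"
    by (intro borel_closed closed_Times compact_imp_closed S closed_UNIV)
  have "(\<lambda>z. indicator (Product_Type.Times S UNIV) z *\<^sub>R (case z of (s, v) \<Rightarrow> h s v)) \<in> borel_measurable borel"
    by (intro borel_measurable_continuous_on_indicator SU cont)
  then have meas: "(\<lambda>(s, v). ?H s v) \<in> borel_measurable (lborel \<Otimes>\<^sub>M lborel)"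
    unfolding eq[symmetric] by (simp add: lborel_prod case_prod_beta')
  have bnd: "norm (?H s v) \<le> C * indicator S s * ?w v" for s v
    using norm_le_of_decay[OF bound, of s v] by (auto simp: indicator_def)
  have int: "integrable (lborel \<Otimes>\<^sub>M lborel) (\<lambda>(s, v). ?H s v)"
  proof (rule Bochner_Integration.integrable_bound[OF _ meas])
    have "integrable lborel (\<lambda>s. indicator S s :: real)"
      using S by (intro integrable_real_indicator)
        (use emeasure_bounded_finite[OF compact_imp_bounded[OF S]] in auto)
    then have "integrable (lborel \<Otimes>\<^sub>M lborel) (\<lambda>(s, v). (C * indicator S s) * ?w v)"
    proof (intro lborel_pair.Fubini_integrable)
      show "(\<lambda>(s, v). (C * indicator S s) * ?w v) \<in> borel_measurable (lborel \<Otimes>\<^sub>M lborel)"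
        by measurable
    qed (simp_all add: norm_mult abs_mult integrable_inverse_power_norm)
    then show "integrable (lborel \<Otimes>\<^sub>M lborel) (\<lambda>(s, v). C * indicator S s * ?w v)" .
    show "AE z in lborel \<Otimes>\<^sub>M lborel. norm (case z of (s, v) \<Rightarrow> ?H s v)
          \<le> norm (case z of (s, v) \<Rightarrow> C * indicator S s * ?w v)"
      using bnd by (intro AE_I2) (auto intro: order_trans[OF _ abs_ge_self])
  qed
  have inner: "(LINT v|lborel. ?H s v) = indicator S s *\<^sub>R (LINT v|lborel. h s v)" for s
    by (cases "s \<in> S") auto
  show "(LINT v|lborel. (LINT s:S|lborel. h s v)) = (LINT s:S|lborel. LINT v|lborel. h s v)"
    using lborel_pair.Fubini_integral[OF int] inner by (simp add: set_lebesgue_integral_def)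
  show "set_integrable lborel S (\<lambda>s. LINT v|lborel. h s v)"
    using lborel_pair.integrable_fst[OF int] inner by (simp add: set_integrable_def)
  show "(LINT z:Product_Type.Times S UNIV|lborel. h (fst z) (snd z)) = (LINT s:S|lborel. LINT v|lborel. h s v)"
    using lborel_pair.integral_fst[OF int] inner
    by (simp add: set_lebesgue_integral_def eq lborel_prod)
qed

lemma
  assumes cont: "continuous_on (Product_Type.Times S T) (\<lambda>(s, v). h s v)"
  shows continuous_on_slice_right: "s \<in> S \<Longrightarrow> continuous_on T (h s)"
    and continuous_on_slice_left: "v \<in> T \<Longrightarrow> continuous_on S (\<lambda>s. h s v)"
  using continuous_on_compose2[OF cont, of T "\<lambda>v. (s, v)"] continuous_on_compose2[OF cont, of S "\<lambda>s. (s, v)"]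
  by (auto simp: continuous_on_Pair continuous_on_const continuous_on_id image_subset_iff)

lemma continuous_on_integral_of_decay:
  fixes h :: "'a::euclidean_space \<Rightarrow> real^3 \<Rightarrow> 'b::euclidean_space"
  assumes cont: "continuous_on (Product_Type.Times S UNIV) (\<lambda>(s, v). h s v)"
    and bound: "\<And>s v. s \<in> S \<Longrightarrow> (1 + norm v) ^ 5 * norm (h s v) \<le> C"
  shows "continuous_on S (\<lambda>s. LINT v|lborel. h s v)"
  unfolding continuous_on_sequentially
proof (intro allI ballI impI)
  fix X s assume s: "s \<in> S" and X: "(\<forall>n. X n \<in> S) \<and> X \<longlonglongrightarrow> s"
  have meas: "h r \<in> borel_measurable lborel" if "r \<in> S" for r
  proof -
    have "continuous_on UNIV (h r)"
      using continuous_on_slice_right[OF cont] that .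
    then show ?thesis
      using borel_measurable_continuous_onI by simp
  qed
  have "(\<lambda>n. LINT v|lborel. h (X n) v) \<longlonglongrightarrow> (LINT v|lborel. h s v)"
  proof (rule integral_dominated_convergence)
    show "integrable lborel (\<lambda>v::real^3. C * inverse ((1 + norm v) ^ 5))"
      by (intro integrable_mult_right integrable_inverse_power_norm)
    show "AE v in lborel. (\<lambda>n. h (X n) v) \<longlonglongrightarrow> h s v"
    proof (rule AE_I2)
      fix v
      have "continuous_on S (\<lambda>r. h r v)"
        by (rule continuous_on_slice_left[OF cont UNIV_I])
      then show "(\<lambda>n. h (X n) v) \<longlonglongrightarrow> h s v"
        using s X unfolding continuous_on_sequentially by (auto simp: comp_def)
    qed
  qed (use s X meas norm_le_of_decay[OF bound] in auto)
  then show "((\<lambda>s. LINT v|lborel. h s v) \<circ> X) \<longlonglongrightarrow> (LINT v|lborel. h s v)"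
    by (simp add: comp_def)
qed

text \<open>
  A proof by translation invariance, with no boundary terms at infinity: \<open>0 = \<integral>(g(v + e) - g(v)) dv\<close>, and
  writing the difference as an integral of \<open>g'(v + s e) e\<close> over \<open>0 \<le> s \<le> 1\<close> and exchanging the integrals
  gives the integral of \<open>g'(v) e\<close>, since each translate has the same integral. The restriction to
  \<open>|e| \<le> 1\<close> bounds the decay of the translates uniformly in \<open>s\<close>.
\<close>

lemma integral_directional_derivative_zero:
  fixes g :: "real^3 \<Rightarrow> 'b::euclidean_space"
  assumes deriv: "\<And>v. (g has_derivative g' v) (at v)"
    and cont: "continuous_on UNIV (\<lambda>v. g' v e)"
    and g_bound: "\<And>v. (1 + norm v) ^ 5 * norm (g v) \<le> C"
    and g'_bound: "\<And>v. (1 + norm v) ^ 5 * norm (g' v e) \<le> C"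
    and e: "norm e \<le> 1"
  shows "(LINT v|lborel. g' v e) = 0"
proof -
  have cont_g: "continuous_on UNIV g"
    using deriv by (meson continuous_at_imp_continuous_on has_derivative_continuous)
  have int_g: "integrable lborel g"
    using cont_g g_bound by (rule integrable_of_decay)
  have shift: "(LINT v|lborel. k (v + a)) = (LINT v|lborel. k v)" if "k \<in> borel_measurable borel"
    for k :: "real^3 \<Rightarrow> 'b" and a
  proof -
    have "(LINT v|lborel. k v) = (LINT v|distr lborel borel ((+) a). k v)"
      by (simp add: lborel_distr_plus)
    also have "\<dots> = (LINT v|lborel. k (a + v))"
      using that by (intro integral_distr) auto
    finally show ?thesis by (simp add: add.commute)
  qed
  have int_shift: "integrable lborel (\<lambda>v. g (v + e))"
  proof -
    have "integrable (distr lborel borel ((+) e)) g"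
      using int_g by (simp add: lborel_distr_plus)
    then show ?thesis
      by (subst (asm) integrable_distr_eq)
        (use borel_measurable_continuous_onI[OF cont_g] in \<open>auto simp: add.commute\<close>)
  qed
  have ftc: "(LINT s:{0..1}|lborel. g' (v + s *\<^sub>R e) e) = g (v + e) - g v" for v
  proof -
    have cont_line: "continuous_on {0..1} (\<lambda>s. g' (v + s *\<^sub>R e) e)"
      by (rule continuous_on_compose2[OF cont]) (auto intro!: continuous_intros)
    have vd: "((\<lambda>s. g (v + s *\<^sub>R e)) has_vector_derivative g' (v + s *\<^sub>R e) e) (at s within {0..1})" for s
    proof -
      have "((\<lambda>s. g (v + s *\<^sub>R e)) has_derivative (\<lambda>r. g' (v + s *\<^sub>R e) (r *\<^sub>R e))) (at s within {0..1})"
        by (rule has_derivative_compose[OF _ deriv, where f = "\<lambda>s. v + s *\<^sub>R e"])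
          (auto intro!: derivative_eq_intros)
      moreover have "linear (g' (v + s *\<^sub>R e))"
        using deriv has_derivative_linear by blast
      ultimately show ?thesis
        by (simp add: has_vector_derivative_def linear_cmul)
    qed
    have "((\<lambda>s. g' (v + s *\<^sub>R e) e) has_integral g (v + 1 *\<^sub>R e) - g (v + 0 *\<^sub>R e)) {0..1}"
      by (rule fundamental_theorem_of_calculus) (use vd in auto)
    then show ?thesis
      using set_borel_integral_eq_integral(2)[OF borel_integrable_atLeastAtMost'[OF cont_line]]
      by (simp add: integral_unique)
  qed
  have bound: "(1 + norm v) ^ 5 * norm (g' (v + s *\<^sub>R e) e) \<le> 2 ^ 5 * C" if "s \<in> {0..1}" for s v
  proof -
    have "norm (s *\<^sub>R e) \<le> 1"
      using that e by (simp add: mult_le_one)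
    then have "1 + norm v \<le> 2 * (1 + norm (v + s *\<^sub>R e))"
      using norm_triangle_ineq4[of "v + s *\<^sub>R e" "s *\<^sub>R e"] norm_ge_zero[of "v + s *\<^sub>R e"] 
      by (simp del: norm_scaleR norm_ge_zero)
    then have "(1 + norm v) ^ 5 \<le> 2 ^ 5 * (1 + norm (v + s *\<^sub>R e)) ^ 5"
      by (subst power_mult_distrib[symmetric]) (intro power_mono, auto)
    then have "(1 + norm v) ^ 5 * norm (g' (v + s *\<^sub>R e) e)
        \<le> 2 ^ 5 * ((1 + norm (v + s *\<^sub>R e)) ^ 5 * norm (g' (v + s *\<^sub>R e) e))"
      by (simp add: mult_right_mono mult.assoc[symmetric] del: power_mult_distrib)
    also have "\<dots> \<le> 2 ^ 5 * C"
      using g'_bound[of "v + s *\<^sub>R e"] by simp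
    finally show ?thesis .
  qed
  have "0 = (LINT v|lborel. g (v + e) - g v)"
    using int_g int_shift shift[of g e] borel_measurable_continuous_onI[OF cont_g] by simp
  also have "\<dots> = (LINT v|lborel. (LINT s:{0..1}|lborel. g' (v + s *\<^sub>R e) e))"
    by (simp add: ftc)
  also have "\<dots> = (LINT s:{0..1}|lborel. LINT v|lborel. g' (v + s *\<^sub>R e) e)"
  proof (rule Fubini_of_decay)
    show "continuous_on (Product_Type.Times {0..1::real} UNIV) (\<lambda>(s, v). g' (v + s *\<^sub>R e) e)"
      unfolding case_prod_beta'
      by (rule continuous_on_compose2[OF cont]) (auto intro!: continuous_intros)
  qed (use bound in auto)
  also have "\<dots> = (LINT s:{0..1::real}|lborel. LINT v|lborel. g' v e)"
    using shift[of "\<lambda>v. g' v e"] borel_measurable_continuous_onI[OF cont] by simp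
  also have "\<dots> = (LINT v|lborel. g' v e)"
    by (simp add: set_lebesgue_integral_def)
  finally show ?thesis by simp
qed

lemma frechet_derivative_eq_grad:
  fixes g :: "real^3 \<Rightarrow> real"
  assumes "g differentiable (at v)"
  shows "frechet_derivative g (at v) h = h \<bullet> grad g v"
proof -
  have lin: "linear (frechet_derivative g (at v))"
    using assms by (rule linear_frechet_derivative)
  have "frechet_derivative g (at v) h = frechet_derivative g (at v) (\<Sum>i\<in>UNIV. (h $ i) *\<^sub>R axis i 1)"
    by (simp add: basis_expansion scalar_mult_eq_scaleR[symmetric])
  also have "\<dots> = h \<bullet> grad g v"
    using lin by (simp add: linear_sum linear_cmul inner_vec_def grad_def pd_def)
  finally show ?thesis .
qed

section \<open>Weak form of the velocity transport term\<close>

lemma norm_cross_le: "norm (x \<times> y) \<le> norm x * norm y" for x y :: "real^3"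
proof (rule power2_le_imp_le)
  show "(norm (x \<times> y))\<^sup>2 \<le> (norm x * norm y)\<^sup>2"
    using norm_cross_dot[of x y] by (metis le_add_same_cancel1 zero_le_power2)
qed simp

text \<open>
  The functions \<open>\<phi>\<close> whose moments \<open>\<integral>\<phi> f dv\<close> can be followed in time: \<open>K\<close> bounds the growth of \<open>\<phi>\<close> and of its
  derivative by that of a quadratic polynomial, as the decay \<open>f = O(|v|\<^sup>-\<^sup>8)\<close> and an affine force require. Values in
  a vector space treat the momentum \<open>\<phi>(v) = v\<close> together with the scalar moments.
\<close>

definition moment_weight ::
  "real \<Rightarrow> (real^3 \<Rightarrow> 'b::euclidean_space) \<Rightarrow> (real^3 \<Rightarrow> real^3 \<Rightarrow> 'b) \<Rightarrow> bool" where
  "moment_weight K \<phi> \<phi>' \<longleftrightarrow>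
     (\<forall>v. (\<phi> has_derivative \<phi>' v) (at v)) \<and> continuous_on UNIV (\<lambda>(v, h). \<phi>' v h) \<and>
     (\<forall>v. norm (\<phi> v) \<le> K * (1 + norm v)\<^sup>2) \<and> (\<forall>v h. norm (\<phi>' v h) \<le> K * (1 + norm v) * norm h)"

text \<open>
  The field \<open>v \<times> b + c\<close> is divergence free, so \<open>(a \<bullet> \<nabla>g) \<phi> + g \<phi>'(a)\<close> is the divergence in \<open>v\<close>
  of \<open>g \<phi> a\<close> and integrates to zero. The three bounds, uniform in \<open>g\<close> for given decay constants, justify the later
  exchanges of the velocity integral with integrals and limits in time and space.
\<close>

lemma
  fixes g :: "real^3 \<Rightarrow> real" and \<phi> :: "real^3 \<Rightarrow> 'b::euclidean_space" and b c :: "real^3"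
  defines "a \<equiv> \<lambda>v. v \<times> b + c"
  assumes g: "\<And>v. g differentiable (at v)" "continuous_on UNIV (grad g)"
    and decay: "\<And>v. (1 + norm v) ^ 8 * \<bar>g v\<bar> \<le> C" "\<And>v. (1 + norm v) ^ 9 * norm (grad g v) \<le> C"
    and weight: "moment_weight K \<phi> \<phi>'"
  shows moment_bound: "\<And>v. (1 + norm v) ^ 5 * norm (g v *\<^sub>R \<phi> v) \<le> K * C"
    and source_bound: "\<And>v. (1 + norm v) ^ 5 * norm (g v *\<^sub>R \<phi>' v (a v)) \<le> (norm b + norm c) * K * C"
    and force_bound: "\<And>v. (1 + norm v) ^ 5 * norm ((a v \<bullet> grad g v) *\<^sub>R \<phi> v) \<le> (norm b + norm c) * K * C"
    and transport_weak_form: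
      "(LINT v|lborel. (a v \<bullet> grad g v) *\<^sub>R \<phi> v) = - (LINT v|lborel. g v *\<^sub>R \<phi>' v (a v))"
proof -
  define A where "A = norm b + norm c"
  have \<phi>: "\<And>v. (\<phi> has_derivative \<phi>' v) (at v)" "continuous_on UNIV (\<lambda>(v, h). \<phi>' v h)"
    and growth: "\<And>v. norm (\<phi> v) \<le> K * (1 + norm v)\<^sup>2" "\<And>v h. norm (\<phi>' v h) \<le> K * (1 + norm v) * norm h"
    using weight by (auto simp: moment_weight_def)
  have A0: "0 \<le> A"
    by (simp add: A_def)
  have C0: "0 \<le> C"
    using order_trans[OF _ decay(1)[of 0], of 0] by simp
  have K0: "0 \<le> K"
    using order_trans[OF norm_ge_zero growth(1)[of 0]] by simp
  have a_le: "norm (a v) \<le> A * (1 + norm v)" for v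
  proof -
    have "norm (a v) \<le> norm v * norm b + norm c"
      unfolding a_def using norm_triangle_ineq[of "v \<times> b" c] norm_cross_le[of v b] by linarith
    also have "\<dots> \<le> A * (1 + norm v)"
      by (simp add: A_def algebra_simps)
    finally show ?thesis .
  qed
  have lin\<phi>: "linear (\<phi>' v)" for v
    using \<phi>(1) has_derivative_linear by blast
  have g_deriv: "(g has_derivative (\<lambda>h. h \<bullet> grad g v)) (at v)" for v
  proof -
    have "frechet_derivative g (at v) = (\<lambda>h. h \<bullet> grad g v)"
      by (rule ext) (rule frechet_derivative_eq_grad[OF g(1)])
    then show ?thesis
      using g(1)[of v] by (simp add: frechet_derivative_works)
  qed
  have cont_g: "continuous_on UNIV g" and cont_\<phi>: "continuous_on UNIV \<phi>"
    using has_derivative_continuous[OF g_deriv] has_derivative_continuous[OF \<phi>(1)]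
    by (auto intro: continuous_at_imp_continuous_on)
  have cont_a: "continuous_on UNIV a"
    unfolding a_def by (intro continuous_intros continuous_on_cross)
  have cont_\<phi>': "continuous_on UNIV (\<lambda>v. \<phi>' v (k v))" if "continuous_on UNIV k" for k
    using continuous_on_compose2[OF \<phi>(2), of UNIV "\<lambda>v. (v, k v)"] that
    by (simp add: continuous_on_Pair continuous_on_id)
  have growth_a: "(1 + norm v) ^ 5 * (\<bar>s\<bar> * \<bar>t\<bar> * norm (\<phi> v)) \<le> A * K * ((1 + norm v) ^ 8 * \<bar>t\<bar>)"
    if "\<bar>s\<bar> \<le> norm (a v)" for s t v
  proof -
    have "(1 + norm v) ^ 5 * (\<bar>s\<bar> * \<bar>t\<bar> * norm (\<phi> v))
      \<le> (1 + norm v) ^ 5 * ((A * (1 + norm v)) * \<bar>t\<bar> * (K * (1 + norm v)\<^sup>2))"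
      using that a_le[of v] growth(1)[of v] A0
      by (intro mult_left_mono mult_mono mult_right_mono) auto
    also have "\<dots> = A * K * ((1 + norm v) ^ 5 * (1 + norm v) * (1 + norm v)\<^sup>2 * \<bar>t\<bar>)"
      by (simp only: mult_ac)
    also have "(1 + norm v) ^ 5 * (1 + norm v) * (1 + norm v)\<^sup>2 = (1 + norm v) ^ (5 + 1 + 2)"
      by (simp only: power_add power_one_right)
    finally show ?thesis by simp
  qed
  have growth_\<phi>': "(1 + norm v) ^ 5 * (\<bar>s\<bar> * \<bar>t\<bar> * norm (\<phi>' v h)) \<le> A * K * ((1 + norm v) ^ 8 * \<bar>t\<bar>)"
    if "\<bar>s\<bar> * norm h \<le> norm (a v)" for s t h v
  proof -
    have "(1 + norm v) ^ 5 * (\<bar>s\<bar> * \<bar>t\<bar> * norm (\<phi>' v h))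
      \<le> (1 + norm v) ^ 5 * (\<bar>s\<bar> * \<bar>t\<bar> * (K * (1 + norm v) * norm h))"
      by (intro mult_left_mono growth(2)) auto
    also have "\<dots> = (1 + norm v) ^ 5 * ((\<bar>s\<bar> * norm h) * \<bar>t\<bar> * (K * (1 + norm v)))"
      by (simp only: mult_ac)
    also have "\<dots> \<le> (1 + norm v) ^ 5 * ((A * (1 + norm v)) * \<bar>t\<bar> * (K * (1 + norm v)))"
      using order_trans[OF that a_le] K0 by (intro mult_left_mono mult_right_mono) auto
    also have "\<dots> = A * K * ((1 + norm v) ^ 5 * (1 + norm v) * (1 + norm v) * \<bar>t\<bar>)"
      by (simp only: mult_ac)
    also have "(1 + norm v) ^ 5 * (1 + norm v) * (1 + norm v) = (1 + norm v) ^ (5 + 1 + 1)"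
      by (simp only: power_add power_one_right)
    also have "A * K * ((1 + norm v) ^ (5 + 1 + 1) * \<bar>t\<bar>) \<le> A * K * ((1 + norm v) ^ 8 * \<bar>t\<bar>)"
      using A0 K0 by (intro mult_left_mono mult_right_mono power_increasing) auto
    finally show ?thesis .
  qed
  have decay_g: "A * K * ((1 + norm v) ^ 8 * \<bar>g v\<bar>) \<le> A * K * C" for v
    using A0 K0 decay(1) by (intro mult_left_mono) auto
  have decay_grad: "A * K * ((1 + norm v) ^ 8 * \<bar>t\<bar>) \<le> A * K * C" if "\<bar>t\<bar> \<le> norm (grad g v)" for t v
  proof -
    have "(1 + norm v) ^ 8 * \<bar>t\<bar> \<le> (1 + norm v) ^ 9 * norm (grad g v)"
      using that by (intro mult_mono power_increasing) auto
    also have "\<dots> \<le> C"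
      by (rule decay(2))
    finally show ?thesis
      using A0 K0 by (intro mult_left_mono) auto
  qed
  show "(1 + norm v) ^ 5 * norm (g v *\<^sub>R \<phi> v) \<le> K * C" for v
  proof -
    have "(1 + norm v) ^ 5 * norm (g v *\<^sub>R \<phi> v) \<le> (1 + norm v) ^ 5 * (\<bar>g v\<bar> * (K * (1 + norm v)\<^sup>2))"
      using growth(1)[of v] by (simp add: mult_left_mono)
    also have "\<dots> = K * ((1 + norm v) ^ 5 * (1 + norm v)\<^sup>2 * \<bar>g v\<bar>)"
      by (simp only: mult_ac)
    also have "\<dots> \<le> K * ((1 + norm v) ^ 8 * \<bar>g v\<bar>)"
      unfolding power_add[symmetric] using K0
      by (intro mult_left_mono mult_right_mono power_increasing) auto
    also have "\<dots> \<le> K * C"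
      using K0 decay(1) by (intro mult_left_mono) auto
    finally show ?thesis .
  qed
  have bound2: "(1 + norm v) ^ 5 * norm (g v *\<^sub>R \<phi>' v (a v)) \<le> A * K * C" for v
    using order_trans[OF growth_\<phi>'[of 1 "a v" v "g v"] decay_g] by simp
  then show "(1 + norm v) ^ 5 * norm (g v *\<^sub>R \<phi>' v (a v)) \<le> (norm b + norm c) * K * C" for v
    unfolding A_def .
  have bound1: "(1 + norm v) ^ 5 * norm ((a v \<bullet> grad g v) *\<^sub>R \<phi> v) \<le> A * K * C" for v
  proof -
    have "(1 + norm v) ^ 5 * norm ((a v \<bullet> grad g v) *\<^sub>R \<phi> v)
        \<le> (1 + norm v) ^ 5 * (\<bar>norm (a v)\<bar> * \<bar>norm (grad g v)\<bar> * norm (\<phi> v))"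
      using Cauchy_Schwarz_ineq2[of "a v" "grad g v"] by (simp add: mult_left_mono mult_right_mono)
    also have "\<dots> \<le> A * K * C"
      by (rule order_trans[OF growth_a decay_grad]) auto
    finally show ?thesis .
  qed
  then show "(1 + norm v) ^ 5 * norm ((a v \<bullet> grad g v) *\<^sub>R \<phi> v) \<le> (norm b + norm c) * K * C" for v
    unfolding A_def .
  have int1: "integrable lborel (\<lambda>v. (a v \<bullet> grad g v) *\<^sub>R \<phi> v)"
    by (rule integrable_of_decay[OF _ bound1]) (intro continuous_intros cont_a cont_\<phi> g(2))
  have int2: "integrable lborel (\<lambda>v. g v *\<^sub>R \<phi>' v (a v))"
    by (rule integrable_of_decay[OF _ bound2]) (intro continuous_intros cont_a cont_\<phi>' cont_g)
  \<comment> \<open>\<open>G' i v\<close> is the derivative at \<open>v\<close> of the \<open>i\<close>-th component of the flux \<open>g \<phi> a\<close>.\<close>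
  define G' where "G' i v h = ((h \<times> b) $ i * g v + a v $ i * (h \<bullet> grad g v)) *\<^sub>R \<phi> v
      + (a v $ i * g v) *\<^sub>R \<phi>' v h" for i v h
  have cross_axis: "(axis i 1 \<times> b) $ i = 0" for i
    using dot_cross_self(1)[of "axis i 1" b] by (simp add: inner_axis')
  have G'_axis: "G' i v (axis i 1) = (a v $ i * grad g v $ i) *\<^sub>R \<phi> v + (a v $ i * g v) *\<^sub>R \<phi>' v (axis i 1)" for i v
    by (simp add: G'_def cross_axis inner_axis')
  have cont_G': "continuous_on UNIV (\<lambda>v. G' i v (axis i 1))" for i
    unfolding G'_axis by (intro continuous_intros cont_a cont_\<phi> cont_\<phi>' cont_g g(2))
  have bound_G': "(1 + norm v) ^ 5 * norm (G' i v (axis i 1)) \<le> 2 * (A * K * C)" for i v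
  proof -
    have "(1 + norm v) ^ 5 * norm (G' i v (axis i 1))
      \<le> (1 + norm v) ^ 5 * (\<bar>a v $ i\<bar> * \<bar>grad g v $ i\<bar> * norm (\<phi> v))
        + (1 + norm v) ^ 5 * (\<bar>a v $ i\<bar> * \<bar>g v\<bar> * norm (\<phi>' v (axis i 1)))"
      unfolding G'_axis distrib_left[symmetric]
      by (intro mult_left_mono order_trans[OF norm_triangle_ineq]) (auto simp: abs_mult)
    also have "\<dots> \<le> A * K * C + A * K * C"
      by (intro add_mono order_trans[OF growth_a decay_grad] order_trans[OF growth_\<phi>' decay_g])
        (auto simp: component_le_norm_cart)
    finally show ?thesis by linarith
  qed
  have zero: "(LINT v|lborel. G' i v (axis i 1)) = 0" for i
  proof (rule integral_directional_derivative_zero[where g' = "G' i" and e = "axis i 1" and C = "2 * (A * K * C)"])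
    show "((\<lambda>v. (a v $ i * g v) *\<^sub>R \<phi> v) has_derivative G' i v) (at v)" for v
    proof -
      have "((\<lambda>v. v \<times> b) has_derivative (\<lambda>h. h \<times> b)) (at v)"
        by (intro linear_imp_has_derivative) (simp add: linear_iff cross_add_left cross_mult_left)
      then have "(a has_derivative (\<lambda>h. h \<times> b)) (at v)"
        unfolding a_def by (auto intro!: derivative_eq_intros)
      then have "((\<lambda>v. a v $ i) has_derivative (\<lambda>h. (h \<times> b) $ i)) (at v)"
        by (rule bounded_linear.has_derivative[OF bounded_linear_vec_nth])
      then show ?thesis
        unfolding G'_def
        by (auto intro!: derivative_eq_intros g_deriv \<phi>(1) simp: algebra_simps)
    qed
    show "(1 + norm v) ^ 5 * norm ((a v $ i * g v) *\<^sub>R \<phi> v) \<le> 2 * (A * K * C)" for v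
    proof -
      have "(1 + norm v) ^ 5 * (\<bar>a v $ i\<bar> * \<bar>g v\<bar> * norm (\<phi> v)) \<le> A * K * C"
        by (rule order_trans[OF growth_a decay_g]) (simp add: component_le_norm_cart)
      also have "\<dots> \<le> 2 * (A * K * C)"
        using A0 K0 C0 by simp
      finally show ?thesis by (simp add: abs_mult)
    qed
  qed (rule cont_G', rule bound_G', simp)
  have "(a v \<bullet> grad g v) *\<^sub>R \<phi> v + g v *\<^sub>R \<phi>' v (a v) = (\<Sum>i\<in>UNIV. G' i v (axis i 1))" for v
  proof -
    have "\<phi>' v (a v) = \<phi>' v (\<Sum>i\<in>UNIV. (a v $ i) *\<^sub>R axis i 1)"
      by (simp add: basis_expansion scalar_mult_eq_scaleR[symmetric])
    also have "\<dots> = (\<Sum>i\<in>UNIV. a v $ i *\<^sub>R \<phi>' v (axis i 1))"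
      using lin\<phi>[of v] by (simp add: linear_sum linear_cmul)
    finally show ?thesis
      by (simp add: G'_axis sum.distrib inner_vec_def scaleR_sum_left scaleR_sum_right mult.commute)
  qed
  then have "(LINT v|lborel. (a v \<bullet> grad g v) *\<^sub>R \<phi> v + g v *\<^sub>R \<phi>' v (a v))
      = (\<Sum>i\<in>UNIV. LINT v|lborel. G' i v (axis i 1))"
    using integrable_of_decay[OF cont_G' bound_G'] by (simp add: Bochner_Integration.integral_sum)
  then show "(LINT v|lborel. (a v \<bullet> grad g v) *\<^sub>R \<phi> v) = - (LINT v|lborel. g v *\<^sub>R \<phi>' v (a v))"
    using int1 int2 by (simp add: zero eq_neg_iff_add_eq_0)
qed

lemma moment_weight_mass: "moment_weight 1 (\<lambda>_. 1 :: real) (\<lambda>_ _. 0)"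
  by (auto simp: moment_weight_def one_le_power)

lemma moment_weight_momentum: "moment_weight 1 (\<lambda>v. v) (\<lambda>_ h. h)"
proof -
  have "norm v \<le> (1 + norm v)\<^sup>2" for v :: "real^3"
    by (simp add: power2_eq_square algebra_simps)
  moreover have "norm h \<le> (1 + norm v) * norm h" for v h :: "real^3"
    by (simp add: algebra_simps)
  ultimately show ?thesis
    by (auto simp: moment_weight_def case_prod_beta' intro!: continuous_intros)
qed

lemma moment_weight_energy: "moment_weight 2 (\<lambda>v. (norm v)\<^sup>2) (\<lambda>v h. 2 * (v \<bullet> h))"
proof -
  have "(norm v)\<^sup>2 \<le> 2 * (1 + norm v)\<^sup>2" for v :: "real^3"
    by (simp add: power2_eq_square algebra_simps)
  moreover have "\<bar>2 * (v \<bullet> h)\<bar> \<le> 2 * (1 + norm v) * norm h" for v h :: "real^3"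
  proof -
    have "\<bar>2 * (v \<bullet> h)\<bar> \<le> 2 * (norm v * norm h)"
      using Cauchy_Schwarz_ineq2[of v h] by (simp add: abs_mult)
    also have "\<dots> \<le> 2 * (1 + norm v) * norm h"
      by (simp add: algebra_simps)
    finally show ?thesis .
  qed
  moreover have "((\<lambda>v. (norm v)\<^sup>2) has_derivative (\<lambda>h. 2 * (v \<bullet> h))) (at v)" for v :: "real^3"
    unfolding power2_norm_eq_inner
    by (auto intro!: derivative_eq_intros simp: inner_commute)
  ultimately show ?thesis
    by (auto simp: moment_weight_def case_prod_beta' intro!: continuous_intros)
qed

section \<open>Moments of a transported distribution\<close>

text \<open>
  The kinetic equation at one position \<open>x\<close>: there \<open>b\<close> is the magnetic field and \<open>c\<close> collects the part of the
  acceleration that does not depend on the velocity.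
\<close>

locale velocity_transport =
  fixes t0 t1 C :: real and b c :: "real^3" and f :: "real \<Rightarrow> real^3 \<Rightarrow> real"
  assumes less: "t0 < t1"
    and cont: "continuous_on (Product_Type.Times {t0..t1} UNIV) (\<lambda>(t, v). f t v)"
    and diff: "\<And>t v. t \<in> {t0..t1} \<Longrightarrow> f t differentiable (at v)"
    and cont_grad: "continuous_on (Product_Type.Times {t0..t1} UNIV) (\<lambda>(t, v). grad (f t) v)"
    and decay: "\<And>t v. t \<in> {t0..t1} \<Longrightarrow> (1 + norm v) ^ 8 * \<bar>f t v\<bar> \<le> C"
    and decay_grad: "\<And>t v. t \<in> {t0..t1} \<Longrightarrow> (1 + norm v) ^ 9 * norm (grad (f t) v) \<le> C"
    and transport: "\<And>t v. t \<in> {t0..t1} \<Longrightarrow>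
      ((\<lambda>s. f s v) has_real_derivative - ((v \<times> b + c) \<bullet> grad (f t) v)) (at t within {t0..t1})"
begin

lemmas cont_at = continuous_on_slice_right[OF cont] and cont_grad_at = continuous_on_slice_right[OF cont_grad]

lemma weak_form:
  assumes "moment_weight K \<phi> \<phi>'" "t \<in> {t0..t1}"
  shows "(LINT v|lborel. ((v \<times> b' + c') \<bullet> grad (f t) v) *\<^sub>R \<phi> v)
       = - (LINT v|lborel. f t v *\<^sub>R \<phi>' v (v \<times> b' + c'))"
  using assms diff cont_grad_at decay decay_grad by (intro transport_weak_form)

lemma integrable_moment:
  assumes weight: "moment_weight K \<phi> \<phi>'" and t: "t \<in> {t0..t1}"
  shows "integrable lborel (\<lambda>v. f t v *\<^sub>R \<phi> v)"
proof (rule integrable_of_decay)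
  have "continuous_on UNIV \<phi>"
    using weight unfolding moment_weight_def
    by (metis continuous_at_imp_continuous_on has_derivative_continuous)
  then show "continuous_on UNIV (\<lambda>v. f t v *\<^sub>R \<phi> v)"
    using cont_at[OF t] by (intro continuous_intros)
  show "(1 + norm v) ^ 5 * norm (f t v *\<^sub>R \<phi> v) \<le> K * C" for v
    using weight t diff cont_grad_at decay decay_grad by (intro moment_bound)
qed

text \<open>
  Integrating the equation in time, exchanging the integrals and applying the weak form yields the integral identity
  \<open>M(r) = M(t0) + \<integral>G(s) ds\<close>, with \<open>s\<close> ranging over
  \<open>{t0..r}\<close>. By dominated convergence \<open>G\<close> is continuous, so this can be differentiated.
\<close>

lemma moment_has_vector_derivative:
  assumes weight: "moment_weight K \<phi> \<phi>'" and t: "t \<in> {t0..t1}"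
  shows "((\<lambda>t. LINT v|lborel. f t v *\<^sub>R \<phi> v) has_vector_derivative
      (LINT v|lborel. f t v *\<^sub>R \<phi>' v (v \<times> b + c))) (at t within {t0..t1})"
proof -
  let ?a = "\<lambda>v. v \<times> b + c"
  let ?M = "\<lambda>t. LINT v|lborel. f t v *\<^sub>R \<phi> v"
  let ?G = "\<lambda>t. LINT v|lborel. f t v *\<^sub>R \<phi>' v (?a v)"
  let ?F = "\<lambda>s v. - (?a v \<bullet> grad (f s) v)"
  have cont_\<phi>: "continuous_on UNIV \<phi>"
    using weight unfolding moment_weight_def
    by (metis continuous_at_imp_continuous_on has_derivative_continuous)
  have cont_a: "continuous_on (Product_Type.Times {t0..t1} UNIV) (\<lambda>z. ?a (snd z))"
    by (intro continuous_intros continuous_on_cross)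
  have cont_F: "continuous_on (Product_Type.Times {t0..t1} UNIV) (\<lambda>(s, v). ?F s v *\<^sub>R \<phi> v)"
    using cont_grad unfolding case_prod_beta'
    by (intro continuous_intros cont_a continuous_on_compose2[OF cont_\<phi>]) auto
  have bound_F: "(1 + norm v) ^ 5 * norm (?F s v *\<^sub>R \<phi> v) \<le> (norm b + norm c) * K * C"
    if "s \<in> {t0..t1}" for s v
    using force_bound[OF diff cont_grad_at decay decay_grad weight, OF that that that that, of v b c] by simp
  have "continuous_on (Product_Type.Times {t0..t1} UNIV) (\<lambda>(s, v). f s v *\<^sub>R \<phi>' v (?a v))"
  proof -
    have "continuous_on UNIV (\<lambda>(v, h). \<phi>' v h)"
      using weight by (simp add: moment_weight_def)
    from continuous_on_compose2[OF this, of "Product_Type.Times {t0..t1} UNIV" "\<lambda>z. (snd z, ?a (snd z))"]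
    have "continuous_on (Product_Type.Times {t0..t1} UNIV) (\<lambda>z. \<phi>' (snd z) (?a (snd z)))"
      using continuous_on_Pair[OF continuous_on_snd[OF continuous_on_id] cont_a] by simp
    then show ?thesis
      using cont unfolding case_prod_beta' by (intro continuous_intros)
  qed
  then have cont_G: "continuous_on {t0..t1} ?G"
    using source_bound[OF diff cont_grad_at decay decay_grad weight]
    by (intro continuous_on_integral_of_decay[where C = "(norm b + norm c) * K * C"])
  have eq: "?M r = ?M t0 + integral {t0..r} ?G" if r: "r \<in> {t0..t1}" for r
  proof -
    have sub: "{t0..r} \<subseteq> {t0..t1}"
      using r by auto
    have ftc: "(LINT s:{t0..r}|lborel. ?F s v *\<^sub>R \<phi> v) = (f r v - f t0 v) *\<^sub>R \<phi> v" for v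
    proof -
      have "continuous_on {t0..r} (\<lambda>s. ?F s v *\<^sub>R \<phi> v)"
        by (rule continuous_on_subset[OF continuous_on_slice_left[OF cont_F UNIV_I] sub])
      moreover have "((\<lambda>s. ?F s v *\<^sub>R \<phi> v) has_integral f r v *\<^sub>R \<phi> v - f t0 v *\<^sub>R \<phi> v) {t0..r}"
      proof (rule fundamental_theorem_of_calculus)
        show "((\<lambda>s. f s v *\<^sub>R \<phi> v) has_vector_derivative ?F s v *\<^sub>R \<phi> v) (at s within {t0..r})"
          if "s \<in> {t0..r}" for s
        proof -
          have "((\<lambda>s. f s v) has_real_derivative ?F s v) (at s within {t0..r})"
            by (rule DERIV_subset[OF transport sub]) (use that sub in auto)
          then show ?thesis
            unfolding has_real_derivative_iff_has_vector_derivative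
            by (rule bounded_linear.has_vector_derivative[OF bounded_linear_scaleR_left])
        qed
      qed (use r in simp)
      ultimately show ?thesis
        unfolding scaleR_diff_left
        by (metis set_borel_integral_eq_integral(2) borel_integrable_atLeastAtMost' integral_unique)
    qed
    have "?M r - ?M t0 = (LINT v|lborel. (f r v - f t0 v) *\<^sub>R \<phi> v)"
      using integrable_moment[OF weight] r less by (simp add: scaleR_diff_left)
    also have "\<dots> = (LINT v|lborel. (LINT s:{t0..r}|lborel. ?F s v *\<^sub>R \<phi> v))"
      by (simp only: ftc)
    also have "\<dots> = (LINT s:{t0..r}|lborel. LINT v|lborel. ?F s v *\<^sub>R \<phi> v)"
    proof (rule Fubini_of_decay)
      show "continuous_on (Product_Type.Times {t0..r} UNIV) (\<lambda>(s, v). ?F s v *\<^sub>R \<phi> v)"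
        using sub by (intro continuous_on_subset[OF cont_F]) auto
      show "(1 + norm v) ^ 5 * norm (?F s v *\<^sub>R \<phi> v) \<le> (norm b + norm c) * K * C" if "s \<in> {t0..r}" for s v
        using that sub by (intro bound_F) auto
    qed simp
    also have "\<dots> = (LINT s:{t0..r}|lborel. ?G s)"
    proof (rule set_lebesgue_integral_cong)
      show "\<forall>s. s \<in> {t0..r} \<longrightarrow> (LINT v|lborel. ?F s v *\<^sub>R \<phi> v) = ?G s"
        using weak_form[OF weight, of _ b c] sub by (simp add: subset_iff)
    qed simp
    also have "\<dots> = integral {t0..r} ?G"
      by (intro set_borel_integral_eq_integral(2) borel_integrable_atLeastAtMost'
          continuous_on_subset[OF cont_G sub])
    finally show ?thesis by (simp add: algebra_simps)
  qed
  have deriv: "((\<lambda>r. ?M t0 + integral {t0..r} ?G) has_vector_derivative ?G t) (at t within {t0..t1})"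
    using has_vector_derivative_add[OF has_vector_derivative_const integral_has_vector_derivative[OF cont_G t]]
    by simp
  show ?thesis
    by (rule has_vector_derivative_transform[OF t _ deriv]) (rule eq)
qed

lemma mass_constant:
  assumes "t \<in> {t0..t1}"
  shows "(LINT v|lborel. f t v) = (LINT v|lborel. f t0 v)"
proof -
  have "((\<lambda>t. LINT v|lborel. f t v) has_vector_derivative 0) (at s within {t0..t1})"
    if "s \<in> {t0..t1}" for s
    using moment_has_vector_derivative[OF moment_weight_mass that] by simp
  then obtain m where "\<And>s. s \<in> {t0..t1} \<Longrightarrow> (LINT v|lborel. f s v) = m"
    using has_vector_derivative_zero_constant[of "{t0..t1}" "\<lambda>t. LINT v|lborel. f t v"] by blast
  then show ?thesis
    using assms less by simp
qed

lemma affine_moment: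
  assumes t: "t \<in> {t0..t1}"
  shows "(LINT v|lborel. f t v *\<^sub>R (v \<times> b' + c'))
    = (LINT v|lborel. f t v *\<^sub>R v) \<times> b' + (LINT v|lborel. f t v) *\<^sub>R c'"
proof -
  have bl: "bounded_linear (\<lambda>v. v \<times> b')"
    by (intro linear_conv_bounded_linear[THEN iffD1]) (simp add: linear_iff cross_add_left cross_mult_left)
  have J: "integrable lborel (\<lambda>v. f t v *\<^sub>R v)" and m: "integrable lborel (f t)"
    using integrable_moment[OF moment_weight_momentum t] integrable_moment[OF moment_weight_mass t] by simp_all
  have "(LINT v|lborel. f t v *\<^sub>R (v \<times> b' + c')) = (LINT v|lborel. (f t v *\<^sub>R v) \<times> b' + f t v *\<^sub>R c')"
    by (simp add: scaleR_add_right cross_mult_left)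
  also have "\<dots> = (LINT v|lborel. (f t v *\<^sub>R v) \<times> b') + (LINT v|lborel. f t v *\<^sub>R c')"
    by (intro Bochner_Integration.integral_add integrable_bounded_linear[OF bl J] integrable_scaleR_left m)
  finally show ?thesis
    using integral_bounded_linear[OF bl J] m by simp
qed

lemma integral_force_momentum:
  assumes "t \<in> {t0..t1}"
  shows "(LINT v|lborel. - ((v \<times> b' + c') \<bullet> grad (f t) v) *\<^sub>R v)
    = (LINT v|lborel. f t v *\<^sub>R v) \<times> b' + (LINT v|lborel. f t0 v) *\<^sub>R c'"
  using weak_form[OF moment_weight_momentum assms, of b' c'] affine_moment[OF assms, of b' c'] mass_constant[OF assms]
  by simp

lemma momentum_has_vector_derivative:
  assumes t: "t \<in> {t0..t1}"
  shows "((\<lambda>t. LINT v|lborel. f t v *\<^sub>R v) has_vector_derivative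
    (LINT v|lborel. f t v *\<^sub>R v) \<times> b + (LINT v|lborel. f t0 v) *\<^sub>R c) (at t within {t0..t1})"
  using moment_has_vector_derivative[OF moment_weight_momentum t] affine_moment[OF t, of b c] mass_constant[OF t]
  by simp

text \<open>
  Uniqueness for the linear equation \<open>u' = u \<times> b + c\<close>: the defect \<open>w = J - \<rho> u\<close> is rotated about \<open>b\<close> without
  changing its length, because \<open>w \<bullet> (w \<times> b) = 0\<close>.
\<close>

lemma momentum_eq:
  fixes u :: "real \<Rightarrow> real^3"
  assumes u: "\<And>t. t \<in> {t0..t1} \<Longrightarrow> (u has_vector_derivative (u t \<times> b + c)) (at t within {t0..t1})"
    and init: "(LINT v|lborel. f t0 v *\<^sub>R v) = (LINT v|lborel. f t0 v) *\<^sub>R u t0"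
    and t: "t \<in> {t0..t1}"
  shows "(LINT v|lborel. f t v *\<^sub>R v) = (LINT v|lborel. f t0 v) *\<^sub>R u t"
proof -
  define m where "m = (LINT v|lborel. f t0 v)"
  define w where "w t = (LINT v|lborel. f t v *\<^sub>R v) - m *\<^sub>R u t" for t
  have w': "(w has_vector_derivative (w t \<times> b)) (at t within {t0..t1})" if "t \<in> {t0..t1}" for t
    unfolding w_def using momentum_has_vector_derivative[OF that] u[OF that]
    by (auto intro!: derivative_eq_intros simp: m_def[symmetric] Cross3.left_diff_distrib cross_mult_left scaleR_add_right)
  have "((\<lambda>t. w t \<bullet> w t) has_vector_derivative 0) (at t within {t0..t1})" if "t \<in> {t0..t1}" for t
  proof -
    have "((\<lambda>t. w t \<bullet> w t) has_derivative (\<lambda>h. w t \<bullet> (h *\<^sub>R (w t \<times> b)) + (h *\<^sub>R (w t \<times> b)) \<bullet> w t))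
        (at t within {t0..t1})"
      using w'[OF that] unfolding has_vector_derivative_def
      by (intro has_derivative_inner)
    then show ?thesis
      by (simp add: has_vector_derivative_def dot_cross_self)
  qed
  then obtain q where "\<And>s. s \<in> {t0..t1} \<Longrightarrow> w s \<bullet> w s = q"
    using has_vector_derivative_zero_constant[of "{t0..t1}" "\<lambda>t. w t \<bullet> w t"] by blast
  then have "w t \<bullet> w t = w t0 \<bullet> w t0"
    using t less by simp
  also have "\<dots> = 0"
    using init by (simp add: w_def m_def)
  finally show ?thesis
    by (simp add: w_def m_def)
qed

text \<open>
  Only \<open>c\<close> does work, since \<open>v \<bullet> (v \<times> b) = 0\<close>.
\<close>

lemma energy_has_vector_derivative:
  assumes t: "t \<in> {t0..t1}"
  shows "((\<lambda>t. LINT v|lborel. (norm v)\<^sup>2 * f t v) has_vector_derivative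
    2 * ((LINT v|lborel. f t v *\<^sub>R v) \<bullet> c)) (at t within {t0..t1})"
proof -
  have "(LINT v|lborel. f t v *\<^sub>R (2 * (v \<bullet> (v \<times> b + c)))) = (LINT v|lborel. 2 * ((f t v *\<^sub>R v) \<bullet> c))"
    by (simp add: inner_add_right dot_cross_self mult.left_commute)
  also have "\<dots> = 2 * ((LINT v|lborel. f t v *\<^sub>R v) \<bullet> c)"
    unfolding integral_mult_right_zero
    using integral_inner_left[OF integrable_moment[OF moment_weight_momentum t], of c] by simp
  finally show ?thesis
    using moment_has_vector_derivative[OF moment_weight_energy t] by (simp add: mult.commute)
qed

end

section \<open>Calculus of smooth fields\<close>

lemma Ck_Suc_imp_differentiable: "Ck (Suc k) g \<Longrightarrow> g differentiable (at x)"
  by simp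

lemma Ck_Suc_imp_Ck: "Ck (Suc k) g \<Longrightarrow> Ck k g"
proof (induction k arbitrary: g)
  case 0
  then show ?case
    by (auto intro!: continuous_at_imp_continuous_on differentiable_imp_continuous_within)
next
  case (Suc k)
  then show ?case by (metis Ck.simps(2))
qed

lemma Ck_mono: "Ck k g \<Longrightarrow> j \<le> k \<Longrightarrow> Ck j g"
  by (induction k rule: nat_induct) (auto simp: le_Suc_eq simp del: Ck.simps intro: Ck_Suc_imp_Ck)

lemma Ck_imp_continuous_on: "Ck k g \<Longrightarrow> continuous_on S g"
  using Ck_mono[of k g 0] by (auto intro: continuous_on_subset)

lemma Ck_SucI:
  assumes "\<And>x. (g has_derivative g' x) (at x)" and "\<And>b. b \<in> Basis \<Longrightarrow> Ck k (\<lambda>x. g' x b)"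
  shows "Ck (Suc k) g"
proof -
  have "frechet_derivative g (at x) = g' x" for x
    using assms(1) frechet_derivative_at by metis
  then show ?thesis
    using assms by (auto simp: differentiable_def)
qed

lemma Ck_has_derivative: "Ck (Suc k) g \<Longrightarrow> (g has_derivative frechet_derivative g (at x)) (at x)"
  by (simp add: frechet_derivative_works)

lemma Ck_const: "Ck k (\<lambda>x. c)"
proof (induction k arbitrary: c)
  case (Suc k)
  show ?case by (rule Ck_SucI[of _ "\<lambda>_ _. 0"]) (auto intro: Suc)
qed auto

lemma Ck_add:
  assumes "Ck k f" "Ck k g" shows "Ck k (\<lambda>x. f x + g x)"
  using assms
proof (induction k arbitrary: f g)
  case (Suc k)
  show ?case
    by (rule Ck_SucI[OF has_derivative_add[OF Ck_has_derivative[OF Suc.prems(1)] Ck_has_derivative[OF Suc.prems(2)]]])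
      (use Suc in auto)
qed (auto intro: continuous_intros)

lemma Ck_sum: "(\<And>i. i \<in> I \<Longrightarrow> Ck k (f i)) \<Longrightarrow> Ck k (\<lambda>x. \<Sum>i\<in>I. f i x)"
  by (induction I rule: infinite_finite_induct) (auto intro: Ck_const Ck_add)

lemma (in bounded_linear) Ck: "Ck k g \<Longrightarrow> Ck k (\<lambda>x. f (g x))"
proof (induction k arbitrary: g)
  case 0
  then show ?case by (simp add: continuous_on)
next
  case (Suc k)
  show ?case
    by (rule Ck_SucI[OF has_derivative[OF Ck_has_derivative[OF Suc.prems]]]) (use Suc in auto)
qed

lemma Ck_diff: "Ck k f \<Longrightarrow> Ck k g \<Longrightarrow> Ck k (\<lambda>x. f x - g x)"
  using Ck_add[of k f "\<lambda>x. - g x"] bounded_linear.Ck[OF bounded_linear_minus[OF bounded_linear_ident], of k g]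
  by simp

lemma (in bounded_bilinear) Ck: "Ck k g \<Longrightarrow> Ck k h \<Longrightarrow> Ck k (\<lambda>x. prod (g x) (h x))"
proof (induction k arbitrary: g h)
  case 0
  then show ?case by (simp add: continuous_on)
next
  case (Suc k)
  show ?case
    by (rule Ck_SucI[OF FDERIV[OF Ck_has_derivative[OF Suc.prems(1)] Ck_has_derivative[OF Suc.prems(2)]]])
      (intro Ck_add Suc.IH, use Suc.prems Ck_Suc_imp_Ck in auto)
qed

lemmas Ck_scaleR = bounded_bilinear.Ck[OF bounded_bilinear_scaleR]
lemmas Ck_mult = bounded_bilinear.Ck[OF bounded_bilinear_mult]
lemmas Ck_inner = bounded_bilinear.Ck[OF bounded_bilinear_inner]

lemma bounded_bilinear_cross: "bounded_bilinear (\<times>)"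
  using bilinear_cross bilinear_conv_bounded_bilinear by blast

lemmas Ck_cross = bounded_bilinear.Ck[OF bounded_bilinear_cross]

lemma Ck_inverse:
  fixes g :: "'a::euclidean_space \<Rightarrow> real"
  assumes "Ck k g" "\<And>x. g x \<noteq> 0"
  shows "Ck k (\<lambda>x. inverse (g x))"
  using assms(1)
proof (induction k)
  case 0
  then show ?case using assms(2) by (simp add: continuous_on_inverse)
next
  case (Suc k)
  let ?g' = "\<lambda>x. frechet_derivative g (at x)"
  have inv: "Ck k (\<lambda>x. inverse (g x))"
    using Suc Ck_Suc_imp_Ck by blast
  show ?case
  proof (rule Ck_SucI)
    show "((\<lambda>x. inverse (g x)) has_derivative (\<lambda>h. - (inverse (g x) * ?g' x h * inverse (g x)))) (at x)" for x
      using Deriv.has_derivative_inverse[OF assms(2) Ck_has_derivative[OF Suc.prems]] by simp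
    show "Ck k (\<lambda>x. - (inverse (g x) * ?g' x b * inverse (g x)))" if "b \<in> Basis" for b
      using Suc.prems that
      by (intro bounded_linear.Ck[OF bounded_linear_minus[OF bounded_linear_ident]] Ck_mult inv) auto
  qed
qed

lemma (in bounded_linear) differentiable: "g differentiable F \<Longrightarrow> (\<lambda>x. f (g x)) differentiable F"
  unfolding differentiable_def using has_derivative by blast

lemma axis_in_Basis_real: "axis i (1::real) \<in> Basis"
  by (simp add: axis_in_Basis_iff)

lemma Ck_pd: "Ck (Suc k) F \<Longrightarrow> Ck k (pd i F)"
  unfolding pd_def[abs_def] using axis_in_Basis_real by auto

lemma Ck_1D:
  assumes "Ck 1 g"
  shows "g differentiable (at x)" "continuous_on S (pd i g)"
  using assms Ck_imp_continuous_on[OF Ck_pd[of 0 g]] by auto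

lemma pd_eqI: "(g has_derivative g') (at x) \<Longrightarrow> pd i g x = g' (axis i 1)"
  unfolding pd_def using frechet_derivative_at by metis

lemma has_derivative_frechet: "g differentiable (at x) \<Longrightarrow> (g has_derivative frechet_derivative g (at x)) (at x)"
  by (simp add: frechet_derivative_works)

lemma pd_add:
  "f differentiable (at x) \<Longrightarrow> g differentiable (at x) \<Longrightarrow> pd i (\<lambda>y. f y + g y) x = pd i f x + pd i g x"
  by (rule pd_eqI[THEN trans, OF has_derivative_add[OF has_derivative_frechet has_derivative_frechet]])
    (simp_all add: pd_def)

lemma pd_diff:
  "f differentiable (at x) \<Longrightarrow> g differentiable (at x) \<Longrightarrow> pd i (\<lambda>y. f y - g y) x = pd i f x - pd i g x"
  by (rule pd_eqI[THEN trans, OF has_derivative_diff[OF has_derivative_frechet has_derivative_frechet]])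
    (simp_all add: pd_def)

lemma pd_sum:
  "(\<And>j. j \<in> I \<Longrightarrow> f j differentiable (at x)) \<Longrightarrow> pd i (\<lambda>y. \<Sum>j\<in>I. f j y) x = (\<Sum>j\<in>I. pd i (f j) x)"
  by (rule pd_eqI[THEN trans, OF has_derivative_sum[OF has_derivative_frechet]]) (simp_all add: pd_def)

lemma (in bounded_linear) pd: "g differentiable (at x) \<Longrightarrow> pd i (\<lambda>y. f (g y)) x = f (pd i g x)"
  by (rule pd_eqI[THEN trans, OF has_derivative[OF has_derivative_frechet]]) (simp_all add: pd_def)

lemma (in bounded_bilinear) pd:
  "g differentiable (at x) \<Longrightarrow> h differentiable (at x) \<Longrightarrow>
    pd i (\<lambda>y. prod (g y) (h y)) x = prod (g x) (pd i h x) + prod (pd i g x) (h x)"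
  by (rule pd_eqI[THEN trans, OF FDERIV[OF has_derivative_frechet has_derivative_frechet]]) (simp_all add: pd_def)

text \<open>
  In the next three identities each operator is a sum over \<open>i\<close> of a fixed linear map applied to the partial
  derivative in direction \<open>i\<close>. Smoothness, periodicity, additivity and vanishing integrals of all three operators then
  follow from the corresponding facts on \<open>pd\<close>.
\<close>

lemma grad_eq_sum: "grad g x = (\<Sum>i\<in>UNIV. pd i g x *\<^sub>R axis i 1)"
  by (simp add: grad_def vec_eq_iff axis_def if_distrib cong: if_cong)

lemma divergence_eq_sum: "divergence F x = (\<Sum>i\<in>UNIV. axis i 1 \<bullet> pd i F x)"
  by (simp add: divergence_def inner_axis')

lemma curl_eq_sum: "curl F x = (\<Sum>i\<in>UNIV. axis i 1 \<times> pd i F x)"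
  by (simp add: curl_def sum_3 vec_eq_iff forall_3 axis_def cross3_def)

lemma Ck_grad: "Ck (Suc k) g \<Longrightarrow> Ck k (grad g)"
  unfolding grad_eq_sum[abs_def] by (intro Ck_sum Ck_scaleR Ck_pd Ck_const)

lemma Ck_divergence: "Ck (Suc k) F \<Longrightarrow> Ck k (divergence F)"
  unfolding divergence_eq_sum[abs_def] by (intro Ck_sum Ck_inner Ck_pd Ck_const)

lemma Ck_curl: "Ck (Suc k) F \<Longrightarrow> Ck k (curl F)"
  unfolding curl_eq_sum[abs_def] by (intro Ck_sum Ck_cross Ck_pd Ck_const)

lemma curl_add:
  "F differentiable (at x) \<Longrightarrow> G differentiable (at x) \<Longrightarrow> curl (\<lambda>y. F y + G y) x = curl F x + curl G x"
  by (simp add: curl_eq_sum pd_add cross_add_right sum.distrib)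

lemma curl_diff:
  "F differentiable (at x) \<Longrightarrow> G differentiable (at x) \<Longrightarrow> curl (\<lambda>y. F y - G y) x = curl F x - curl G x"
  by (simp add: curl_eq_sum pd_diff Cross3.right_diff_distrib sum_subtractf)

lemma divergence_cross:
  assumes "F differentiable (at x)" "G differentiable (at x)"
  shows "divergence (\<lambda>y. F y \<times> G y) x = curl F x \<bullet> G x - F x \<bullet> curl G x"
  unfolding divergence_def bounded_bilinear.pd[OF bounded_bilinear_cross assms]
  by (simp add: curl_def cross3_def inner_vec_def sum_3 algebra_simps)

lemma divergence_scaleR:
  assumes "p differentiable (at x)" "F differentiable (at x)"
  shows "divergence (\<lambda>y. p y *\<^sub>R F y) x = grad p x \<bullet> F x + p x * divergence F x"
  unfolding divergence_def bounded_bilinear.pd[OF bounded_bilinear_scaleR assms]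
  by (simp add: grad_def inner_vec_def sum.distrib sum_distrib_left)

text \<open>
  The first and last terms on the right form the divergence of the Maxwell stress \<open>B B - |B|\<^sup>2 / 2\<close>.
\<close>

lemma curl_cross_self:
  assumes B: "B differentiable (at x)"
  shows "curl B x \<times> B x = (\<Sum>i\<in>UNIV. pd i (\<lambda>y. (B y $ i) *\<^sub>R B y) x)
    - divergence B x *\<^sub>R B x - grad (\<lambda>y. (B y \<bullet> B y) / 2) x"
proof -
  have Bi: "pd i (\<lambda>y. (B y $ j) *\<^sub>R B y) x = (B x $ j) *\<^sub>R pd i B x + (pd i B x $ j) *\<^sub>R B x" for i j
    by (subst bounded_bilinear.pd[OF bounded_bilinear_scaleR _ B])
      (simp_all add: bounded_linear.pd[OF bounded_linear_vec_nth B]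
        bounded_linear.differentiable[OF bounded_linear_vec_nth B])
  have BB: "pd i (\<lambda>y. (B y \<bullet> B y) / 2) x = B x \<bullet> pd i B x" for i
    by (subst bounded_linear.pd[OF bounded_linear_divide])
      (simp_all add: B differentiable_inner bounded_bilinear.pd[OF bounded_bilinear_inner B B] inner_commute)
  show ?thesis
    unfolding Bi grad_eq_sum BB divergence_def
    by (simp add: curl_def cross3_def inner_vec_def sum_3 vec_eq_iff forall_3 axis_def algebra_simps)
qed

lemma Ck_half: "Ck k a \<Longrightarrow> Ck k b \<Longrightarrow> Ck k (half a b)"
  unfolding half_def[abs_def] midpoint_def by (intro Ck_scaleR Ck_const Ck_add)

lemma divergence_half:
  assumes "F differentiable (at x)" "G differentiable (at x)"
  shows "divergence (half F G) x = (divergence F x + divergence G x) / 2"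
proof -
  have "pd i (half F G) x = (1/2) *\<^sub>R (pd i F x + pd i G x)" for i
    unfolding half_def[abs_def] midpoint_def
    by (subst bounded_linear.pd[OF bounded_linear_scaleR_right]) (simp_all add: assms pd_add differentiable_add)
  then show ?thesis
    by (simp add: divergence_def sum.distrib sum_divide_distrib[symmetric] add_divide_distrib)
qed

section \<open>Mixed partial derivatives\<close>

lemma has_vector_derivative_along_axis:
  assumes "\<And>x. g differentiable (at x)"
  shows "((\<lambda>r. g (x + r *\<^sub>R axis i 1)) has_vector_derivative pd i g (x + r *\<^sub>R axis i 1)) (at r within S)"
proof -
  let ?e = "axis i 1 :: real^3" and ?g' = "frechet_derivative g (at (x + r *\<^sub>R axis i 1))"
  have "((\<lambda>r. g (x + r *\<^sub>R ?e)) has_derivative (\<lambda>s. ?g' (s *\<^sub>R ?e))) (at r within S)"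
    by (rule has_derivative_compose[OF _ has_derivative_frechet[OF assms], where f = "\<lambda>s. x + s *\<^sub>R ?e"])
      (auto intro!: derivative_eq_intros)
  moreover have "linear ?g'"
    using assms by (rule linear_frechet_derivative)
  ultimately show ?thesis
    by (simp add: has_vector_derivative_def pd_def linear_cmul)
qed

text \<open>
  The increment of \<open>pd j g\<close> along direction \<open>i\<close> equals the integral of \<open>pd j (pd i g)\<close>: write the increment of
  \<open>g\<close> as an integral of \<open>pd i g\<close> and differentiate under the integral in direction \<open>j\<close>. Differentiating this
  identity in direction \<open>i\<close> exchanges the two derivatives.
\<close>

lemma pd_commute:
  fixes g :: "real^3 \<Rightarrow> 'b::banach"
  assumes g: "Ck 2 g"
  shows "pd i (pd j g) x = pd j (pd i g) x"
proof -
  let ?ei = "axis i 1 :: real^3" and ?ej = "axis j 1 :: real^3"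
  have C1: "Ck (Suc 0) (pd k g)" for k
    using g by (intro Ck_pd) (simp add: numeral_2_eq_2)
  have dg: "g differentiable (at y)" and dpd: "pd k g differentiable (at y)" for y k
    using g C1[of k] Ck_Suc_imp_differentiable by (auto simp: numeral_2_eq_2)
  have cont: "continuous_on S (pd k g)" and cont2: "continuous_on S (pd l (pd k g))" for S k l
    using Ck_imp_continuous_on[OF C1] Ck_imp_continuous_on[OF Ck_pd[OF C1]] by auto
  have ftc: "integral {0..s} (\<lambda>r. pd i g (x + r *\<^sub>R ?ei + t *\<^sub>R ?ej))
      = g (x + s *\<^sub>R ?ei + t *\<^sub>R ?ej) - g (x + t *\<^sub>R ?ej)" if "0 \<le> s" for s t
  proof -
    have "((\<lambda>r. pd i g ((x + t *\<^sub>R ?ej) + r *\<^sub>R ?ei)) has_integral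
        g ((x + t *\<^sub>R ?ej) + s *\<^sub>R ?ei) - g ((x + t *\<^sub>R ?ej) + 0 *\<^sub>R ?ei)) {0..s}"
      by (rule fundamental_theorem_of_calculus[OF that has_vector_derivative_along_axis[OF dg]])
    then show ?thesis
      by (simp add: integral_unique algebra_simps)
  qed
  have eq: "pd j g (x + s *\<^sub>R ?ei) - pd j g x = integral {0..s} (\<lambda>r. pd j (pd i g) (x + r *\<^sub>R ?ei))"
    if s: "0 \<le> s" for s
  proof -
    have "((\<lambda>t. integral (cbox 0 s) (\<lambda>r. pd i g (x + r *\<^sub>R ?ei + t *\<^sub>R ?ej))) has_vector_derivative
        integral (cbox 0 s) (\<lambda>r. pd j (pd i g) (x + r *\<^sub>R ?ei + 0 *\<^sub>R ?ej))) (at 0 within UNIV)"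
    proof (rule leibniz_rule_vector_derivative[where fx = "\<lambda>t r. pd j (pd i g) (x + r *\<^sub>R ?ei + t *\<^sub>R ?ej)"])
      show "((\<lambda>t. pd i g (x + r *\<^sub>R ?ei + t *\<^sub>R ?ej)) has_vector_derivative
          pd j (pd i g) (x + r *\<^sub>R ?ei + t *\<^sub>R ?ej)) (at t within UNIV)" for t r
        by (rule has_vector_derivative_along_axis[OF dpd])
      show "(\<lambda>r. pd i g (x + r *\<^sub>R ?ei + t *\<^sub>R ?ej)) integrable_on cbox 0 s" for t
        by (intro integrable_continuous continuous_on_compose2[OF cont[of UNIV]] continuous_intros) auto
      show "continuous_on (Product_Type.Times UNIV (cbox 0 s)) (\<lambda>(t, r). pd j (pd i g) (x + r *\<^sub>R ?ei + t *\<^sub>R ?ej))"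
        unfolding case_prod_beta'
        by (intro continuous_on_compose2[OF cont2[of UNIV]] continuous_intros) auto
    qed auto
    moreover have "((\<lambda>t. g (x + s *\<^sub>R ?ei + t *\<^sub>R ?ej) - g (x + t *\<^sub>R ?ej)) has_vector_derivative
        pd j g (x + s *\<^sub>R ?ei + 0 *\<^sub>R ?ej) - pd j g (x + 0 *\<^sub>R ?ej)) (at 0 within UNIV)"
      by (intro has_vector_derivative_diff has_vector_derivative_along_axis[OF dg])
    ultimately show ?thesis
      using vector_derivative_unique_at by (fastforce simp: ftc[OF s])
  qed
  have "((\<lambda>s. pd j g (x + s *\<^sub>R ?ei) - pd j g x) has_vector_derivative pd i (pd j g) (x + 0 *\<^sub>R ?ei) - 0) (at 0 within {0..1})"
    by (intro has_vector_derivative_diff has_vector_derivative_const has_vector_derivative_along_axis[OF dpd])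
  then have D1: "((\<lambda>s. pd j g (x + s *\<^sub>R ?ei) - pd j g x) has_vector_derivative pd i (pd j g) x) (at 0 within {0..1})"
    by simp
  have "continuous_on {0..1} (\<lambda>r. pd j (pd i g) (x + r *\<^sub>R ?ei))"
    by (intro continuous_on_compose2[OF cont2[of UNIV]] continuous_intros) auto
  from integral_has_vector_derivative[OF this, of 0]
  have D2: "((\<lambda>s. integral {0..s} (\<lambda>r. pd j (pd i g) (x + r *\<^sub>R ?ei))) has_vector_derivative pd j (pd i g) x) (at 0 within {0..1})"
    by simp
  have "((\<lambda>s. pd j g (x + s *\<^sub>R ?ei) - pd j g x) has_vector_derivative pd j (pd i g) x) (at 0 within {0..1})"
    by (rule has_vector_derivative_transform[OF _ _ D2]) (use eq in auto)
  with D1 show ?thesis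
    using vector_derivative_unique_within_closed_interval[of "0::real" 1 0] by (simp add: cbox_interval)
qed

lemma divergence_curl:
  assumes E: "Ck 2 E"
  shows "divergence (curl E) x = 0"
proof -
  have "pd i E differentiable (at y)" for i y
    using Ck_Suc_imp_differentiable[OF Ck_pd] E by (simp add: numeral_2_eq_2 del: Ck.simps)
  then have d: "pd i E differentiable (at y)" "(\<lambda>z. axis k 1 \<times> pd i E z) differentiable (at y)" for i k y
    by (simp, intro bounded_linear.differentiable[OF bounded_bilinear.bounded_linear_right[OF bounded_bilinear_cross]])
  have "pd j (curl E) x = (\<Sum>i\<in>UNIV. axis i 1 \<times> pd j (pd i E) x)" for j
    unfolding curl_eq_sum[abs_def]
    by (simp add: pd_sum d bounded_linear.pd[OF bounded_bilinear.bounded_linear_right[OF bounded_bilinear_cross]])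
  then show ?thesis
    using pd_commute[OF E, of 1 2 x] pd_commute[OF E, of 1 3 x] pd_commute[OF E, of 2 3 x]
    by (simp add: divergence_def sum_3 cross3_def axis_def)
qed

section \<open>Integration over the periodic box\<close>

lemma periodic_half: "periodic L a \<Longrightarrow> periodic L b \<Longrightarrow> periodic L (half a b)"
  by (simp add: periodic_def half_def)

lemma periodic_pd:
  assumes "periodic L g" "\<And>x. g differentiable (at x)"
  shows "periodic L (pd i g)"
  unfolding periodic_def
proof (intro allI)
  fix x j
  let ?a = "axis j (L $ j)"
  have "((\<lambda>y. g (y + ?a)) has_derivative (\<lambda>h. frechet_derivative g (at (x + ?a)) h)) (at x)"
    by (rule has_derivative_compose[OF _ has_derivative_frechet[OF assms(2)], where f = "\<lambda>y. y + ?a"])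
      (auto intro!: derivative_eq_intros)
  moreover have "(\<lambda>y. g (y + ?a)) = g"
    using assms(1) by (simp add: periodic_def)
  ultimately have "(g has_derivative frechet_derivative g (at (x + ?a))) (at x)"
    by simp
  from pd_eqI[OF this] show "pd i g (x + ?a) = pd i g x"
    by (simp add: pd_def)
qed

lemma periodic_curl: "periodic L F \<Longrightarrow> (\<And>x. F differentiable (at x)) \<Longrightarrow> periodic L (curl F)"
  using periodic_pd[of L F] by (simp add: periodic_def curl_eq_sum)

lemma periodic_grad: "periodic L g \<Longrightarrow> (\<And>x. g differentiable (at x)) \<Longrightarrow> periodic L (grad g)"
  using periodic_pd[of L g] by (simp add: periodic_def grad_eq_sum)

text \<open>
  The shifted box sticks out of the original one by a slab of width \<open>r\<close>; moving that slab back by one period fills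
  the gap left on the other side.
\<close>

lemma integral_periodic_shift:
  fixes h :: "real^3 \<Rightarrow> 'b::euclidean_space"
  assumes per: "periodic L h" and cont: "continuous_on UNIV h" and r: "0 \<le> r" "r \<le> L $ i"
  shows "integral (cbox 0 L) (\<lambda>x. h (x + r *\<^sub>R axis i 1)) = integral (cbox 0 L) h"
proof -
  let ?e = "axis i 1 :: real^3"
  \<comment> \<open>\<open>Q s t\<close> is the integral over the slab \<open>s \<le> x $ i \<le> t\<close>, the other coordinates ranging over the box.\<close>
  define Q where "Q s t = integral (cbox (s *\<^sub>R ?e) (L + (t - L $ i) *\<^sub>R ?e)) h" for s t
  have mem: "x \<in> cbox (s *\<^sub>R ?e) (L + (t - L $ i) *\<^sub>R ?e) \<longleftrightarrow>
      s \<le> x $ i \<and> x $ i \<le> t \<and> (\<forall>j. j \<noteq> i \<longrightarrow> 0 \<le> x $ j \<and> x $ j \<le> L $ j)" for x s t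
    by (simp add: mem_box_cart axis_def) (metis (full_types))
  have split: "Q s t = Q s m + Q m t" if "s \<le> m" "m \<le> t" for s m t
  proof -
    let ?box = "cbox (s *\<^sub>R ?e) (L + (t - L $ i) *\<^sub>R ?e)"
    have "?box \<inter> {x. x \<bullet> ?e \<le> m} = cbox (s *\<^sub>R ?e) (L + (m - L $ i) *\<^sub>R ?e)"
      and "?box \<inter> {x. m \<le> x \<bullet> ?e} = cbox (m *\<^sub>R ?e) (L + (t - L $ i) *\<^sub>R ?e)"
      using that by (auto simp: set_eq_iff mem inner_axis simp del: mem_box_cart)
    then show ?thesis
      using integral_split[OF integrable_continuous[OF continuous_on_subset[OF cont subset_UNIV]]
          axis_in_Basis_real[of i], of "s *\<^sub>R ?e" "L + (t - L $ i) *\<^sub>R ?e" m]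
      by (simp add: Q_def)
  qed
  have shift: "integral (cbox (s *\<^sub>R ?e) (L + (t - L $ i) *\<^sub>R ?e)) (\<lambda>x. h (x + d *\<^sub>R ?e)) = Q (s + d) (t + d)" for s t d
    using integral_shift_cbox_plus[of "s *\<^sub>R ?e" "L + (t - L $ i) *\<^sub>R ?e" h "d *\<^sub>R ?e"]
    by (simp add: Q_def comp_def algebra_simps)
  have "(\<lambda>x. h (x + (L $ i) *\<^sub>R ?e)) = h"
  proof -
    have "(L $ i) *\<^sub>R ?e = axis i (L $ i)"
      by (simp add: vec_eq_iff axis_def)
    then show ?thesis using per by (simp add: periodic_def)
  qed
  then have wrap: "Q s t = Q (s + L $ i) (t + L $ i)" for s t
    using shift[of s t "L $ i"] by (simp add: Q_def)
  have "integral (cbox 0 L) (\<lambda>x. h (x + r *\<^sub>R ?e)) = Q r (L $ i + r)"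
    using shift[of 0 "L $ i" r] by simp
  also have "\<dots> = Q r (L $ i) + Q (L $ i) (L $ i + r)"
    by (rule split) (use r in auto)
  also have "Q (L $ i) (L $ i + r) = Q 0 r"
    using wrap[of 0 r] by (simp add: add.commute)
  also have "Q r (L $ i) + Q 0 r = Q 0 (L $ i)"
    using split[of 0 r "L $ i"] r by simp
  finally show ?thesis by (simp add: Q_def)
qed

lemma set_integrable_continuous:
  fixes h :: "'a::euclidean_space \<Rightarrow> 'b::euclidean_space"
  shows "continuous_on (cbox a b) h \<Longrightarrow> set_integrable lborel (cbox a b) h"
  unfolding set_integrable_def by (rule borel_integrable_compact[OF compact_cbox])

text \<open>
  Integrated over a full period along direction \<open>i\<close>, the derivative vanishes at every \<open>x\<close>. Averaging this over the box and
  exchanging the integrals gives \<open>L $ i\<close> times the wanted integral, because all shifts of \<open>pd i g\<close> have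
  the same integral over the box.
\<close>

lemma integral_pd_periodic:
  fixes g :: "real^3 \<Rightarrow> 'b::euclidean_space"
  assumes L: "\<forall>i. L $ i > 0" and per: "periodic L g" and g: "Ck 1 g"
  shows "(LINT x:cbox 0 L|lborel. pd i g x) = 0"
proof -
  let ?e = "axis i 1 :: real^3"
  note dg = Ck_1D(1)[OF g] and cont = Ck_1D(2)[OF g]
  have per': "periodic L (pd i g)"
    by (rule periodic_pd[OF per dg])
  have "integral (cbox 0 (L $ i)) (\<lambda>r. pd i g (x + r *\<^sub>R ?e)) = 0" for x
  proof -
    have "((\<lambda>r. pd i g (x + r *\<^sub>R ?e)) has_integral g (x + (L $ i) *\<^sub>R ?e) - g (x + 0 *\<^sub>R ?e)) {0..L $ i}"
      by (rule fundamental_theorem_of_calculus[OF _ has_vector_derivative_along_axis[OF dg]])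
        (use L in \<open>simp add: less_imp_le\<close>)
    moreover have "(L $ i) *\<^sub>R ?e = axis i (L $ i)"
      by (simp add: vec_eq_iff axis_def)
    ultimately show ?thesis
      using per by (simp add: periodic_def integral_unique)
  qed
  then have "0 = integral (cbox 0 L) (\<lambda>x. integral (cbox 0 (L $ i)) (\<lambda>r. pd i g (x + r *\<^sub>R ?e)))"
    by simp
  also have "\<dots> = integral (cbox 0 (L $ i)) (\<lambda>r. integral (cbox 0 L) (\<lambda>x. pd i g (x + r *\<^sub>R ?e)))"
    by (rule integral_swap_continuous)
      (auto simp: case_prod_beta' intro!: continuous_on_compose2[OF cont[of UNIV]] continuous_intros)
  also have "\<dots> = integral (cbox 0 (L $ i)) (\<lambda>r. integral (cbox 0 L) (pd i g))"
    by (intro integral_cong integral_periodic_shift[OF per' cont]) auto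
  also have "\<dots> = (L $ i) *\<^sub>R integral (cbox 0 L) (pd i g)"
    using L by (simp add: less_imp_le)
  finally have "integral (cbox 0 L) (pd i g) = 0"
    using L by (metis less_irrefl scaleR_eq_0_iff)
  then show ?thesis
    using set_borel_integral_eq_integral(2)[OF set_integrable_continuous[OF cont]] by simp
qed

lemma integral_sum_pd_periodic:
  fixes F :: "3 \<Rightarrow> real^3 \<Rightarrow> 'b::euclidean_space"
  assumes L: "\<forall>i. L $ i > 0" and F: "\<And>i. periodic L (F i)" "\<And>i. Ck 1 (F i)"
    and T: "\<And>i. bounded_linear (T i)"
  shows "(LINT x:cbox 0 L|lborel. (\<Sum>i\<in>UNIV. T i (pd i (F i) x) :: 'c::euclidean_space)) = 0"
proof -
  have int: "set_integrable lborel (cbox 0 L) (pd i (F i))" for i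
    by (intro set_integrable_continuous Ck_1D F)
  have "(LINT x:cbox 0 L|lborel. T i (pd i (F i) x)) = T i (LINT x:cbox 0 L|lborel. pd i (F i) x)" for i
    using integral_bounded_linear[OF T int[of i, unfolded set_integrable_def], of i]
    by (simp add: set_lebesgue_integral_def bounded_linear.linear[OF T, THEN linear_cmul])
  then have zero: "(LINT x:cbox 0 L|lborel. T i (pd i (F i) x)) = 0" for i
    using integral_pd_periodic[OF L F] bounded_linear.linear[OF T] by (simp add: linear_0)
  have "set_integrable lborel (cbox 0 L) (\<lambda>x. T i (pd i (F i) x))" for i
    using integrable_bounded_linear[OF T int[of i, unfolded set_integrable_def], of i]
    by (simp add: set_integrable_def bounded_linear.linear[OF T, THEN linear_cmul])
  then show ?thesis
    using zero unfolding set_lebesgue_integral_def set_integrable_def scaleR_sum_right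
    by (subst Bochner_Integration.integral_sum) simp_all
qed

lemma integral_divergence_periodic:
  assumes "\<forall>i. L $ i > 0" "periodic L F" "Ck 1 F"
  shows "(LINT x:cbox 0 L|lborel. divergence F x) = 0"
  unfolding divergence_eq_sum
  using assms by (intro integral_sum_pd_periodic bounded_linear_inner_right)

lemma integral_grad_periodic:
  assumes "\<forall>i. L $ i > 0" "periodic L g" "Ck 1 g"
  shows "(LINT x:cbox 0 L|lborel. grad g x) = 0"
  unfolding grad_eq_sum
  using assms by (intro integral_sum_pd_periodic bounded_linear_scaleR_left)

lemma integral_Lorentz_force_periodic:
  assumes L: "\<forall>i. L $ i > 0" and per: "periodic L B" and B: "Ck 1 B" and div: "\<And>x. divergence B x = 0"
  shows "(LINT x:cbox 0 L|lborel. curl B x \<times> B x) = 0"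
proof -
  have C1: "Ck 1 (\<lambda>y. (B y $ i) *\<^sub>R B y)" for i
    by (intro Ck_scaleR bounded_linear.Ck[OF bounded_linear_vec_nth] B)
  have C1': "Ck 1 (\<lambda>y. (B y \<bullet> B y) / 2)"
    by (intro bounded_linear.Ck[OF bounded_linear_divide] Ck_inner B)
  have "(LINT x:cbox 0 L|lborel. curl B x \<times> B x)
      = (LINT x:cbox 0 L|lborel. (\<Sum>i\<in>UNIV. pd i (\<lambda>y. (B y $ i) *\<^sub>R B y) x) - grad (\<lambda>y. (B y \<bullet> B y) / 2) x)"
    by (simp add: curl_cross_self[OF Ck_1D(1)[OF B]] div)
  also have "\<dots> = (LINT x:cbox 0 L|lborel. (\<Sum>i\<in>UNIV. pd i (\<lambda>y. (B y $ i) *\<^sub>R B y) x))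
      - (LINT x:cbox 0 L|lborel. grad (\<lambda>y. (B y \<bullet> B y) / 2) x)"
  proof (intro set_integral_diff set_integrable_continuous)
    show "continuous_on (cbox 0 L) (\<lambda>x. \<Sum>i\<in>UNIV. pd i (\<lambda>y. (B y $ i) *\<^sub>R B y) x)"
      by (intro continuous_on_sum Ck_1D C1)
    show "continuous_on (cbox 0 L) (grad (\<lambda>y. (B y \<bullet> B y) / 2))"
      using Ck_imp_continuous_on[OF Ck_grad[of 0]] C1' by simp
  qed
  also have "(LINT x:cbox 0 L|lborel. (\<Sum>i\<in>UNIV. pd i (\<lambda>y. (B y $ i) *\<^sub>R B y) x)) = 0"
    using per by (intro integral_sum_pd_periodic[OF L _ C1 bounded_linear_ident]) (simp add: periodic_def)
  also have "(LINT x:cbox 0 L|lborel. grad (\<lambda>y. (B y \<bullet> B y) / 2) x) = 0"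
    using per by (intro integral_grad_periodic[OF L _ C1']) (simp add: periodic_def)
  finally show ?thesis by simp
qed

section \<open>One step of the scheme\<close>

lemma velocity_transportI:
  assumes "t0 < t1" "C1_in_velocity t0 t1 f" "vlasov_solution t0 t1 \<rho> ub Bh ph f"
    and C: "\<And>t x v. t \<in> {t0..t1} \<Longrightarrow> (1 + norm v) ^ 8 * \<bar>f t x v\<bar> \<le> C"
      "\<And>t x v. t \<in> {t0..t1} \<Longrightarrow> (1 + norm v) ^ 9 * norm (grad (f t x) v) \<le> C"
    and a: "\<And>v. acceleration \<rho> ub Bh ph x v = v \<times> Bh x + c"
  shows "velocity_transport t0 t1 C (Bh x) c (\<lambda>t. f t x)"
proof
  have "continuous_on (Product_Type.Times {t0..t1} UNIV) (\<lambda>(t, x, v). f t x v)"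
    "continuous_on (Product_Type.Times {t0..t1} UNIV) (\<lambda>(t, x, v). grad (f t x) v)"
    using assms(2) by (auto simp: C1_in_velocity_def)
  from this[THEN continuous_on_compose2, of "Product_Type.Times {t0..t1} UNIV" "\<lambda>(t, v). (t, x, v)"]
  show "continuous_on (Product_Type.Times {t0..t1} UNIV) (\<lambda>(t, v). f t x v)"
    "continuous_on (Product_Type.Times {t0..t1} UNIV) (\<lambda>(t, v). grad (f t x) v)"
    by (simp_all add: case_prod_beta' image_subset_iff continuous_on_Pair continuous_on_fst continuous_on_snd
        continuous_on_const continuous_on_id)
  show "((\<lambda>s. f s x v) has_real_derivative - ((v \<times> Bh x + c) \<bullet> grad (f t x) v)) (at t within {t0..t1})"
    if "t \<in> {t0..t1}" for t v
    using assms(3) that by (simp add: vlasov_solution_def a[symmetric])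
qed (use assms in \<open>auto simp: C1_in_velocity_def\<close>)

lemma
  assumes f: "C1_in_velocity t0 t1 f" "decays_in_velocity t0 t1 f" and t: "t \<in> {t0..t1}"
    and weight: "moment_weight K \<phi> \<phi>'"
  shows phase_space_moment: "(LINT z:phase_space L|lborel. f t (fst z) (snd z) *\<^sub>R \<phi> (snd z))
      = (LINT x:cbox 0 L|lborel. LINT v|lborel. f t x v *\<^sub>R \<phi> v)"
    and set_integrable_moment: "set_integrable lborel (cbox 0 L) (\<lambda>x. LINT v|lborel. f t x v *\<^sub>R \<phi> v)"
proof -
  obtain C where C: "\<And>x v. (1 + norm v) ^ 8 * \<bar>f t x v\<bar> \<le> C"
      "\<And>x v. (1 + norm v) ^ 9 * norm (grad (f t x) v) \<le> C"
    using f(2) t unfolding decays_in_velocity_def by meson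
  have cont: "continuous_on UNIV (\<lambda>(x, v). f t x v)" "continuous_on UNIV (\<lambda>(x, v). grad (f t x) v)"
    using f(1) t continuous_on_slice_right[of "{t0..t1}" UNIV "\<lambda>t (x, v). f t x v"]
      continuous_on_slice_right[of "{t0..t1}" UNIV "\<lambda>t (x, v). grad (f t x) v"]
    by (auto simp: C1_in_velocity_def)
  have cont_\<phi>: "continuous_on UNIV \<phi>"
    using weight unfolding moment_weight_def
    by (metis continuous_at_imp_continuous_on has_derivative_continuous)
  have cont_S: "continuous_on (Product_Type.Times (cbox 0 L) UNIV) (\<lambda>(x, v). f t x v *\<^sub>R \<phi> v)"
    unfolding case_prod_beta'
    using continuous_on_subset[OF cont(1)] unfolding case_prod_beta'
    by (intro continuous_intros continuous_on_compose2[OF cont_\<phi>]) auto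
  have cont_grad: "continuous_on UNIV (grad (f t x))" for x
    using continuous_on_slice_right[of UNIV UNIV "\<lambda>x. grad (f t x)" x] cont(2) by simp
  have diff: "f t x differentiable (at v)" for x v
    using f(1) t by (simp add: C1_in_velocity_def)
  have bound: "(1 + norm v) ^ 5 * norm (f t x v *\<^sub>R \<phi> v) \<le> K * C" for x v
    by (rule moment_bound[OF diff cont_grad C weight])
  show "(LINT z:phase_space L|lborel. f t (fst z) (snd z) *\<^sub>R \<phi> (snd z))
      = (LINT x:cbox 0 L|lborel. LINT v|lborel. f t x v *\<^sub>R \<phi> v)"
    unfolding phase_space_def by (rule integral_pair_of_decay[OF compact_cbox cont_S bound])
  show "set_integrable lborel (cbox 0 L) (\<lambda>x. LINT v|lborel. f t x v *\<^sub>R \<phi> v)"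
    by (rule set_integrable_of_decay[OF compact_cbox cont_S bound])
qed

text \<open>
  The force on the momentum and its power are affine in the velocity \<open>u\<close>, so their time integrals over the
  step depend on \<open>u\<close> only through its average \<open>ub\<close>.
\<close>

lemma integral_affine_mean:
  fixes u :: "real \<Rightarrow> 'a::euclidean_space" and T :: "'a \<Rightarrow> 'b::euclidean_space"
  assumes dt: "dt > 0" and u: "continuous_on {t0..t0 + dt} u" and T: "bounded_linear T"
    and mean: "w = (1 / dt) *\<^sub>R (LINT t:{t0..t0 + dt}|lborel. u t)"
  shows "(LINT t:{t0..t0 + dt}|lborel. T (u t) + k) = dt *\<^sub>R (T w + k)"
proof -
  have int: "set_integrable lborel {t0..t0 + dt} u"
    by (rule borel_integrable_atLeastAtMost'[OF u])
  have intT: "set_integrable lborel {t0..t0 + dt} (\<lambda>t. T (u t))"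
    by (intro borel_integrable_atLeastAtMost' bounded_linear.continuous_on[OF T u])
  have "(LINT t:{t0..t0 + dt}|lborel. T (u t)) = T (LINT t:{t0..t0 + dt}|lborel. u t)"
    using integral_bounded_linear[OF T int[unfolded set_integrable_def]]
    by (simp add: set_lebesgue_integral_def bounded_linear.linear[OF T, THEN linear_cmul])
  also have "(LINT t:{t0..t0 + dt}|lborel. u t) = dt *\<^sub>R w"
    using dt mean by simp
  finally have "(LINT t:{t0..t0 + dt}|lborel. T (u t)) = dt *\<^sub>R T w"
    by (simp add: bounded_linear.linear[OF T, THEN linear_cmul])
  moreover have "set_integrable lborel {t0..t0 + dt} (\<lambda>t. k)"
    by (intro borel_integrable_atLeastAtMost' continuous_on_const)
  moreover have "(LINT t:{t0..t0 + dt}|lborel. k) = dt *\<^sub>R k"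
    using dt by (simp add: set_lebesgue_integral_def)
  ultimately show ?thesis
    using intT by (simp add: scaleR_add_right)
qed

theorem theorem4p2:
  fixes L :: "real^3" and \<gamma> tn dt :: real
    and f :: "real \<Rightarrow> real^3 \<Rightarrow> real^3 \<Rightarrow> real"
    and fn fn1 :: "real^3 \<Rightarrow> real^3 \<Rightarrow> real"
    and Bn Bn1 Bh ub :: "real^3 \<Rightarrow> real^3"
    and pn pn1 ph \<rho> :: "real^3 \<Rightarrow> real"
    and u :: "real \<Rightarrow> real^3 \<Rightarrow> real^3"
  assumes "\<forall>i. L $ i > 0" and "\<gamma> \<noteq> 1" and "dt > 0"
    and half_B: "Bh = half Bn Bn1" and half_p: "ph = half pn pn1"
    and rho: "\<rho> = mass_density fn" "\<forall>x. \<rho> x > 0"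
    and periodic: "\<forall>t\<in>{tn..tn + dt}. periodic L (f t)"
      "periodic L Bn" "periodic L Bn1" "periodic L pn" "periodic L pn1" "periodic L ub"
    and smooth: "C1_in_velocity tn (tn + dt) f" "Ck 2 \<rho>"
      "Ck 3 Bn" "Ck 3 Bn1" "Ck 3 pn" "Ck 3 pn1" "Ck 2 ub"
    and decay: "decays_in_velocity tn (tn + dt) f"
    and div_free: "\<forall>x. divergence Bn x = 0"
    and step_i: "f tn = fn" "vlasov_solution tn (tn + dt) \<rho> ub Bh ph f" "fn1 = f (tn + dt)"
    and step_ii: "faraday_step dt \<rho> ub Bh ph Bn Bn1"
    and step_iii: "pressure_step dt \<gamma> \<rho> ub Bh ph pn pn1"
    and step_iv: "\<forall>x. u tn x = mean_velocity fn x"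
      "velocity_solution tn (tn + dt) \<rho> ub Bh ph u"
      "\<forall>x. ub x = (1 / dt) *\<^sub>R (LINT t:{tn..tn + dt}|lborel. u t x)"
  shows "total_mass L fn1 = total_mass L fn
    \<and> total_momentum L fn1 = total_momentum L fn
    \<and> total_energy \<gamma> L fn1 Bn1 pn1 = total_energy \<gamma> L fn Bn pn
    \<and> (\<forall>x. J_contribution tn (tn + dt) f x (\<lambda>v. v \<times> Bh x)
           + J_contribution tn (tn + dt) f x (\<lambda>v. - (ub x \<times> Bh x)) = 0)
    \<and> (\<forall>x. Jf fn1 x - Jf fn x = dt *\<^sub>R (curl Bh x \<times> Bh x) - dt *\<^sub>R grad ph x)"
proof -
  define t1 where "t1 = tn + dt"
  have less: "tn < t1" and tn: "tn \<in> {tn..t1}" and t1: "t1 \<in> {tn..t1}"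
    using \<open>dt > 0\<close> by (auto simp: t1_def)
  note L = \<open>\<forall>i. L $ i > 0\<close>
  note smooth' = smooth(1)[folded t1_def] and decay' = decay[folded t1_def]
    and vlasov = step_i(2)[folded t1_def] and vel = step_iv(2)[folded t1_def]
  define c where "c x = ((1 / \<rho> x) *\<^sub>R curl Bh x) \<times> Bh x - ub x \<times> Bh x - (1 / \<rho> x) *\<^sub>R grad ph x" for x
  have acc: "acceleration \<rho> ub Bh ph x v = v \<times> Bh x + c x" for x v
    by (simp add: acceleration_def c_def Cross3.left_diff_distrib cross_add_left)
  obtain C where C: "\<And>t x v. t \<in> {tn..t1} \<Longrightarrow> (1 + norm v) ^ 8 * \<bar>f t x v\<bar> \<le> C"
      "\<And>t x v. t \<in> {tn..t1} \<Longrightarrow> (1 + norm v) ^ 9 * norm (grad (f t x) v) \<le> C"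
    using decay' unfolding decays_in_velocity_def by meson
  have VT: "velocity_transport tn t1 C (Bh x) (c x) (\<lambda>t. f t x)" for x
    by (rule velocity_transportI[OF less smooth' vlasov C acc])
  have \<rho>0: "(LINT v|lborel. f tn x v) = \<rho> x" for x
    using rho step_i by (simp add: mass_density_def)
  have mass: "(LINT v|lborel. f t x v) = \<rho> x" if "t \<in> {tn..t1}" for t x
    using velocity_transport.mass_constant[OF VT that] \<rho>0 by simp
  have \<rho>_pos: "\<rho> x \<noteq> 0" for x
    using rho(2) by (metis less_irrefl)
  have u': "((\<lambda>t. u t x) has_vector_derivative (u t x \<times> Bh x + c x)) (at t within {tn..t1})"
    if "t \<in> {tn..t1}" for t x
    using vel that by (simp add: velocity_solution_def acc)
  have u_cont: "continuous_on {tn..t1} (\<lambda>t. u t x)" for x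
    using u' has_vector_derivative_continuous by (metis continuous_on_eq_continuous_within)
  have J: "(LINT v|lborel. f t x v *\<^sub>R v) = \<rho> x *\<^sub>R u t x" if "t \<in> {tn..t1}" for t x
  proof -
    have "(LINT v|lborel. f tn x v *\<^sub>R v) = (LINT v|lborel. f tn x v) *\<^sub>R u tn x"
      using step_iv(1) step_i(1) \<rho>_pos[of x] \<rho>0 rho(1) by (simp add: mean_velocity_def Jf_def)
    from velocity_transport.momentum_eq[OF VT u' this that] show ?thesis
      by (simp add: \<rho>0)
  qed
  have mean: "(LINT t:{tn..t1}|lborel. T (u t x) + k) = dt *\<^sub>R (T (ub x) + k)" if "bounded_linear T"
    for T :: "real^3 \<Rightarrow> 'b::euclidean_space" and k x
    using integral_affine_mean[OF \<open>dt > 0\<close> u_cont[unfolded t1_def] that step_iv(3)[rule_format]]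
    by (simp add: t1_def)
  have bl_cross: "bounded_linear (\<lambda>w. w \<times> y)" for y :: "real^3"
    by (rule bounded_bilinear.bounded_linear_left[OF bounded_bilinear_cross])
  \<comment> \<open>In the average over the step \<open>ub \<times> Bh\<close> drops out: this is the cancellation.\<close>
  have \<rho>c: "\<rho> x *\<^sub>R (ub x \<times> Bh x + c x) = curl Bh x \<times> Bh x - grad ph x" for x
    using \<rho>_pos[of x] by (simp add: c_def scaleR_diff_right scaleR_add_right cross_mult_left)

  have Jdiff: "Jf fn1 x - Jf fn x = dt *\<^sub>R (curl Bh x \<times> Bh x) - dt *\<^sub>R grad ph x" for x
  proof -
    have "((\<lambda>t. u t x \<times> Bh x + c x) has_integral u t1 x - u tn x) {tn..t1}"
      by (rule fundamental_theorem_of_calculus) (use less u' in auto)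
    moreover have "continuous_on {tn..t1} (\<lambda>t. u t x \<times> Bh x + c x)"
      by (intro continuous_on_add continuous_on_cross u_cont continuous_on_const)
    ultimately have "u t1 x - u tn x = (LINT t:{tn..t1}|lborel. u t x \<times> Bh x + c x)"
      by (metis set_borel_integral_eq_integral(2) borel_integrable_atLeastAtMost' integral_unique)
    also have "\<dots> = dt *\<^sub>R (ub x \<times> Bh x + c x)"
      by (rule mean[OF bl_cross])
    finally have "\<rho> x *\<^sub>R u t1 x - \<rho> x *\<^sub>R u tn x = dt *\<^sub>R \<rho> x *\<^sub>R (ub x \<times> Bh x + c x)"
      by (metis scaleR_diff_right scaleR_left_commute)
    then show ?thesis
      using J[OF t1] J[OF tn] step_i by (simp add: Jf_def \<rho>c t1_def scaleR_diff_right)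
  qed

  have contribution: "J_contribution tn (tn + dt) f x (\<lambda>v. v \<times> b' + c') = dt *\<^sub>R \<rho> x *\<^sub>R (ub x \<times> b' + c')" for x b' c'
  proof -
    have "J_contribution tn (tn + dt) f x (\<lambda>v. v \<times> b' + c') = (LINT t:{tn..t1}|lborel. (\<rho> x *\<^sub>R u t x) \<times> b' + \<rho> x *\<^sub>R c')"
      unfolding J_contribution_def t1_def[symmetric]
      using velocity_transport.integral_force_momentum[OF VT] J \<rho>0
      by (intro set_lebesgue_integral_cong) auto
    also have "\<dots> = dt *\<^sub>R ((\<rho> x *\<^sub>R ub x) \<times> b' + \<rho> x *\<^sub>R c')"
      by (rule mean[OF bounded_linear_compose[OF bl_cross bounded_linear_scaleR_right]])
    finally show ?thesis
      by (simp add: scaleR_add_right cross_mult_left)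
  qed
  have cancel: "J_contribution tn (tn + dt) f x (\<lambda>v. v \<times> Bh x)
      + J_contribution tn (tn + dt) f x (\<lambda>v. - (ub x \<times> Bh x)) = 0" for x
    using contribution[of x "Bh x" 0] contribution[of x 0 "- (ub x \<times> Bh x)"] by simp

  have mass_total: "total_mass L fn1 = total_mass L fn"
    using phase_space_moment[OF smooth' decay' t1 moment_weight_mass, of L]
      phase_space_moment[OF smooth' decay' tn moment_weight_mass, of L] step_i
    by (simp add: total_mass_def mass[OF t1] mass[OF tn, unfolded step_i(1)] t1_def[symmetric])

  have Bh3: "Ck 3 Bh" and ph3: "Ck 3 ph" and per_Bh: "periodic L Bh" and per_ph: "periodic L ph"
    unfolding half_B half_p using smooth(3-6) periodic by (auto intro: Ck_half periodic_half simp del: Ck.simps)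
  have \<rho>2: "Ck 2 (\<lambda>x. 1 / \<rho> x)"
    using Ck_inverse[OF smooth(2) \<rho>_pos] by (simp add: inverse_eq_divide)
  have curl2: "Ck 2 (curl Bh)" and grad2: "Ck 2 (grad ph)"
    using Ck_curl[of 2 Bh] Ck_grad[of 2 ph] Bh3 ph3 by (simp_all add: eval_nat_numeral del: Ck.simps)
  have Bh2: "Ck 2 Bh" and ph2: "Ck 2 ph"
    using Ck_mono[OF Bh3] Ck_mono[OF ph3] by auto
  have "periodic L fn"
    using periodic(1) tn step_i(1) by (auto simp: t1_def)
  then have per_\<rho>: "periodic L \<rho>"
    by (simp add: periodic_def rho(1) mass_density_def)
  have d_Bh: "Bh differentiable (at x)" and d_ph: "ph differentiable (at x)" for x
    using Ck_mono[OF Bh3, of 1] Ck_mono[OF ph3, of 1] Ck_1D(1) by auto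
  have per_curl: "periodic L (curl Bh)" and per_grad: "periodic L (grad ph)"
    by (intro periodic_curl periodic_grad per_Bh per_ph d_Bh d_ph)+
  define E1 where "E1 = (\<lambda>y. ub y \<times> Bh y)"
  define E2 where "E2 = (\<lambda>y. ((1 / \<rho> y) *\<^sub>R curl Bh y) \<times> Bh y)"
  define E3 where "E3 = (\<lambda>y. (1 / \<rho> y) *\<^sub>R grad ph y)"
  \<comment> \<open>The electric field of the step up to sign, so that the Faraday step reads \<open>Bn1 = Bn + dt curl E\<close>.\<close>
  define E where "E = (\<lambda>y. E1 y - E2 y + E3 y)"
  define ue where "ue = electron_velocity \<rho> ub Bh"
  have E2s: "Ck 2 E1" "Ck 2 E2" "Ck 2 E3"
    unfolding E1_def E2_def E3_def by (intro Ck_cross Ck_scaleR \<rho>2 curl2 grad2 Bh2 smooth(7))+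
  then have E2: "Ck 2 E"
    unfolding E_def by (intro Ck_add Ck_diff)
  have ue2: "Ck 2 ue"
    unfolding ue_def electron_velocity_def[abs_def] by (intro Ck_diff Ck_scaleR \<rho>2 curl2 smooth(7))
  have diff2: "F differentiable (at x)" if "Ck 2 F" for F :: "real^3 \<Rightarrow> 'b::real_normed_vector" and x
    using Ck_1D(1)[OF Ck_mono[OF that]] by simp
  have per_E: "periodic L E" and per_ue: "periodic L ue"
    using per_\<rho> per_curl per_grad per_Bh periodic(6)
    by (simp_all add: periodic_def E_def E1_def E2_def E3_def ue_def electron_velocity_def)

  have faraday: "Bn1 x - Bn x = dt *\<^sub>R curl E x" for x
  proof -
    have "curl E x = curl E1 x - curl E2 x + curl E3 x"
      unfolding E_def using E2s by (simp add: curl_add curl_diff diff2 differentiable_diff del: Ck.simps)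
    also have "\<dots> = (1 / dt) *\<^sub>R (Bn1 x - Bn x)"
      using step_ii by (simp add: faraday_step_def E1_def E2_def E3_def)
    finally show ?thesis
      using \<open>dt > 0\<close> by simp
  qed
  have d_B: "Bn differentiable (at x)" "Bn1 differentiable (at x)" for x
    using Ck_mono[OF smooth(3), of 1] Ck_mono[OF smooth(4), of 1] Ck_1D(1) by auto
  have div_Bh: "divergence Bh x = 0" for x
  proof -
    have "Bn1 = (\<lambda>x. Bn x + dt *\<^sub>R curl E x)"
      using faraday by (auto simp: fun_eq_iff algebra_simps)
    moreover have dc: "curl E differentiable (at x)"
      using Ck_curl[of 1 E] E2 Ck_1D(1) by (simp add: numeral_2_eq_2 del: Ck.simps)
    ultimately have "pd i Bn1 x = pd i Bn x + dt *\<^sub>R pd i (curl E) x" for i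
      using d_B(1)[of x] by (simp add: pd_add bounded_linear.pd[OF bounded_linear_scaleR_right] differentiable_scaleR)
    then have "divergence Bn1 x = divergence Bn x + dt * divergence (curl E) x"
      by (simp add: divergence_def sum.distrib sum_distrib_left)
    then show ?thesis
      using div_free divergence_curl[OF E2] by (simp add: half_B divergence_half d_B)
  qed

  have momentum_total: "total_momentum L fn1 = total_momentum L fn"
  proof -
    have eq: "total_momentum L (f t) = (LINT x:cbox 0 L|lborel. Jf (f t) x)"
      and int: "set_integrable lborel (cbox 0 L) (Jf (f t))" if "t \<in> {tn..t1}" for t
      using phase_space_moment[OF smooth' decay' that moment_weight_momentum, of L]
        set_integrable_moment[OF smooth' decay' that moment_weight_momentum, of L]
      by (simp_all add: total_momentum_def Jf_def[abs_def])
    have int1: "set_integrable lborel (cbox 0 L) (\<lambda>x. dt *\<^sub>R (curl Bh x \<times> Bh x))"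
      and int2: "set_integrable lborel (cbox 0 L) (\<lambda>x. dt *\<^sub>R grad ph x)"
      by (intro set_integrable_continuous continuous_intros continuous_on_cross Ck_imp_continuous_on[OF curl2]
          Ck_imp_continuous_on[OF grad2] Ck_imp_continuous_on[OF Bh2])+
    have "total_momentum L fn1 - total_momentum L fn = (LINT x:cbox 0 L|lborel. Jf fn1 x - Jf fn x)"
      using eq[OF t1] eq[OF tn] set_integral_diff(2)[OF int[OF t1] int[OF tn]] step_i by (simp add: t1_def)
    also have "\<dots> = dt *\<^sub>R (LINT x:cbox 0 L|lborel. curl Bh x \<times> Bh x) - dt *\<^sub>R (LINT x:cbox 0 L|lborel. grad ph x)"
      unfolding Jdiff set_integral_diff(2)[OF int1 int2] by simp
    also have "\<dots> = 0"
      using integral_Lorentz_force_periodic[OF L per_Bh _ div_Bh] integral_grad_periodic[OF L per_ph]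
        Ck_mono[OF Bh3, of 1] Ck_mono[OF ph3, of 1] by simp
    finally show ?thesis by simp
  qed

  define k where "k t x = (LINT v|lborel. (norm v)\<^sup>2 * f t x v)" for t x
  have kdiff: "k t1 x - k tn x = 2 * dt * (\<rho> x *\<^sub>R ub x \<bullet> c x)" for x
  proof -
    have "((\<lambda>t. 2 * (\<rho> x *\<^sub>R u t x \<bullet> c x)) has_integral k t1 x - k tn x) {tn..t1}"
    proof (rule fundamental_theorem_of_calculus)
      show "((\<lambda>t. k t x) has_vector_derivative 2 * (\<rho> x *\<^sub>R u t x \<bullet> c x)) (at t within {tn..t1})"
        if "t \<in> {tn..t1}" for t
        using velocity_transport.energy_has_vector_derivative[OF VT that, of x] J[OF that, of x] by (simp add: k_def)
    qed (use less in simp)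
    moreover have "continuous_on {tn..t1} (\<lambda>t. 2 * (\<rho> x *\<^sub>R u t x \<bullet> c x))"
      by (intro continuous_intros u_cont)
    ultimately have "k t1 x - k tn x = (LINT t:{tn..t1}|lborel. 2 * (\<rho> x *\<^sub>R u t x \<bullet> c x))"
      by (metis set_borel_integral_eq_integral(2) borel_integrable_atLeastAtMost' integral_unique)
    also have "\<dots> = dt *\<^sub>R (2 * (\<rho> x *\<^sub>R ub x \<bullet> c x))"
      using mean[of "\<lambda>w. 2 * (\<rho> x *\<^sub>R w \<bullet> c x)" x 0,
          OF bounded_linear_const_mult[OF bounded_linear_inner_left_comp[OF bounded_linear_scaleR_right]]]
      by simp
    finally show ?thesis by simp
  qed
  define e where "e x = 1/2 * (k t1 x - k tn x) + 1/2 * ((norm (Bn1 x))\<^sup>2 - (norm (Bn x))\<^sup>2)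
    + (pn1 x / (\<gamma> - 1) - pn x / (\<gamma> - 1))" for x
  have e_eq: "e x = dt * divergence (\<lambda>y. E y \<times> Bh y) x - dt * (\<gamma> / (\<gamma> - 1)) * divergence (\<lambda>y. ph y *\<^sub>R ue y) x" for x
  proof -
    have kin: "1/2 * (k t1 x - k tn x) = dt * (ub x \<bullet> (curl Bh x \<times> Bh x) - ub x \<bullet> grad ph x)"
    proof -
      have "\<rho> x *\<^sub>R ub x \<bullet> c x = ub x \<bullet> (\<rho> x *\<^sub>R (ub x \<times> Bh x + c x))"
        by (simp add: inner_add_right dot_cross_self)
      then show ?thesis
        by (simp only: kdiff \<rho>c inner_diff_right)
    qed
    have mag: "1/2 * ((norm (Bn1 x))\<^sup>2 - (norm (Bn x))\<^sup>2) = dt * (divergence (\<lambda>y. E y \<times> Bh y) x + E x \<bullet> curl Bh x)"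
    proof -
      have "1/2 * ((norm (Bn1 x))\<^sup>2 - (norm (Bn x))\<^sup>2) = (Bn1 x - Bn x) \<bullet> Bh x"
        by (simp add: power2_norm_eq_inner half_B half_def midpoint_def inner_diff_left inner_add_right inner_commute algebra_simps)
      then show ?thesis
        by (simp add: faraday divergence_cross[OF diff2[OF E2] d_Bh])
    qed
    have pre: "pn1 x / (\<gamma> - 1) - pn x / (\<gamma> - 1)
        = dt * (grad ph x \<bullet> ue x - \<gamma> / (\<gamma> - 1) * divergence (\<lambda>y. ph y *\<^sub>R ue y) x)"
    proof -
      define D where "D = divergence (\<lambda>y. ph y *\<^sub>R ue y) x"
      have D: "D = grad ph x \<bullet> ue x + ph x * divergence ue x"
        unfolding D_def by (rule divergence_scaleR[OF d_ph diff2[OF ue2]])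
      have "(pn1 x - pn x) / dt + D + (\<gamma> - 1) * (ph x * divergence ue x) = 0"
        using step_iii by (simp add: pressure_step_def ue_def D_def mult.assoc)
      then have rate: "(pn1 x - pn x) / dt = (\<gamma> - 1) * (grad ph x \<bullet> ue x) - \<gamma> * D"
        using D by (simp add: left_diff_distrib algebra_simps)
      have "pn1 x / (\<gamma> - 1) - pn x / (\<gamma> - 1) = (pn1 x - pn x) / (\<gamma> - 1)"
        by (simp add: diff_divide_distrib)
      also have "\<dots> = dt * ((pn1 x - pn x) / dt) / (\<gamma> - 1)"
        using \<open>dt > 0\<close> by simp
      also have "\<dots> = dt * (((\<gamma> - 1) * (grad ph x \<bullet> ue x) - \<gamma> * D) / (\<gamma> - 1))"
        unfolding rate by simp
      also have "\<dots> = dt * (grad ph x \<bullet> ue x - \<gamma> / (\<gamma> - 1) * D)"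
        using \<open>\<gamma> \<noteq> 1\<close> by (simp add: diff_divide_distrib)
      finally show ?thesis unfolding D_def .
    qed
    \<comment> \<open>The exchanges between kinetic, magnetic and internal energy balance at each point, up to divergences.\<close>
    have "ub x \<bullet> (curl Bh x \<times> Bh x) - ub x \<bullet> grad ph x + E x \<bullet> curl Bh x + grad ph x \<bullet> ue x = 0"
      by (simp add: E_def E1_def E2_def E3_def ue_def electron_velocity_def cross3_def inner_vec_def sum_3 algebra_simps)
    then have "dt * (ub x \<bullet> (curl Bh x \<times> Bh x) - ub x \<bullet> grad ph x) + dt * (E x \<bullet> curl Bh x)
        + dt * (grad ph x \<bullet> ue x) = 0"
      by (simp only: distrib_left[symmetric] mult_zero_right)
    then show ?thesis
      unfolding e_def kin mag pre unfolding distrib_left right_diff_distrib mult.assoc by linarith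
  qed
  have energy_total: "total_energy \<gamma> L fn1 Bn1 pn1 = total_energy \<gamma> L fn Bn pn"
  proof -
    have eq: "(LINT z:phase_space L|lborel. (norm (snd z))\<^sup>2 * f t (fst z) (snd z)) = (LINT x:cbox 0 L|lborel. k t x)"
      and int: "set_integrable lborel (cbox 0 L) (k t)" if "t \<in> {tn..t1}" for t
      using phase_space_moment[OF smooth' decay' that moment_weight_energy, of L]
        set_integrable_moment[OF smooth' decay' that moment_weight_energy, of L]
      by (simp_all add: k_def[abs_def] mult.commute)
    have int': "set_integrable lborel (cbox 0 L) (\<lambda>x. (norm (Bn x))\<^sup>2)"
      "set_integrable lborel (cbox 0 L) (\<lambda>x. (norm (Bn1 x))\<^sup>2)"
      "set_integrable lborel (cbox 0 L) (\<lambda>x. pn x / (\<gamma> - 1))"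
      "set_integrable lborel (cbox 0 L) (\<lambda>x. pn1 x / (\<gamma> - 1))"
      using \<open>\<gamma> \<noteq> 1\<close>
      by (auto intro!: set_integrable_continuous continuous_intros smooth(3-6)[THEN Ck_imp_continuous_on] simp del: Ck.simps)
    have "(LINT x:cbox 0 L|lborel. e x)
        = 1/2 * ((LINT x:cbox 0 L|lborel. k t1 x) - (LINT x:cbox 0 L|lborel. k tn x))
        + 1/2 * ((LINT x:cbox 0 L|lborel. (norm (Bn1 x))\<^sup>2) - (LINT x:cbox 0 L|lborel. (norm (Bn x))\<^sup>2))
        + ((LINT x:cbox 0 L|lborel. pn1 x / (\<gamma> - 1)) - (LINT x:cbox 0 L|lborel. pn x / (\<gamma> - 1)))"
      unfolding e_def using int[OF t1] int[OF tn] int'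
      by (simp add: set_integral_add set_integral_diff del: times_divide_eq_left)
    then have "total_energy \<gamma> L fn1 Bn1 pn1 - total_energy \<gamma> L fn Bn pn = (LINT x:cbox 0 L|lborel. e x)"
      unfolding total_energy_def step_i(3) step_i(1)[symmetric] t1_def[symmetric] eq[OF t1] eq[OF tn]
      by (simp only: algebra_simps)
    also have "\<dots> = dt * (LINT x:cbox 0 L|lborel. divergence (\<lambda>y. E y \<times> Bh y) x)
        - dt * (\<gamma> / (\<gamma> - 1)) * (LINT x:cbox 0 L|lborel. divergence (\<lambda>y. ph y *\<^sub>R ue y) x)"
    proof -
      have "set_integrable lborel (cbox 0 L) (divergence F)" if "Ck 2 F" for F
        using Ck_divergence[of 1 F] that
        by (intro set_integrable_continuous Ck_imp_continuous_on) (simp add: numeral_2_eq_2 del: Ck.simps)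
      then show ?thesis
        unfolding e_eq by (subst set_integral_diff) (simp_all add: E2 ue2 Bh2 ph2 Ck_cross Ck_scaleR del: Ck.simps)
    qed
    also have "\<dots> = 0"
    proof -
      have "Ck 1 (\<lambda>y. E y \<times> Bh y)" "Ck 1 (\<lambda>y. ph y *\<^sub>R ue y)"
        using Ck_mono[OF Ck_cross[OF E2 Bh2]] Ck_mono[OF Ck_scaleR[OF ph2 ue2]] by (simp_all del: Ck.simps)
      moreover have "periodic L (\<lambda>y. E y \<times> Bh y)" "periodic L (\<lambda>y. ph y *\<^sub>R ue y)"
        using per_E per_Bh per_ph per_ue by (simp_all add: periodic_def)
      ultimately show ?thesis
        using integral_divergence_periodic[OF L] by simp
    qed
    finally show ?thesis by simp
  qed
  show ?thesis
    using mass_total momentum_total energy_total cancel Jdiff by blast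
qed


end
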